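(* The real pseudo-projective space $\Psi\mathbf{RP}^3\subset\Psi\mathbf{CP}^3$ is a special Lagrangian submanifold of the nearly Calabi-Yau manifold $\Psi\mathbf{CP}^3$ (with the $SU(3)$-structure $(\Omega,\Psi)$ defined in the context).
   Context: Let $\mathbf{H}$ be the quaternions, written $q=z+jw$ with $z,w\in\mathbf{C}$, $j^2=-1$, $zj=j\bar z$. Identify $\mathbf{C}^4=\mathbf{H}^2$ by $(z_1,z_2,z_3,z_4)\sim(z_1+jz_2,\,z_3+jz_4)$, with scalars acting on the right, and put $\langle(q_1,q_2),(p_1,p_2)\rangle=\overline{q_1}p_1-\overline{q_2}p_2$. Let $\Psi S^7=\{(p,q)\in\mathbf{H}^2:\overline pp-\overline qq=1\}$ and $\Psi\mathbf{CP}^3=\Psi S^7/S^1$, where $S^1$ is the group of unit complex numbers acting on the right; this is the twistor space of hyperbolic $4$-space $H^4=\Psi S^7/S^3$ ($S^3$ = unit quaternions). Let $\Psi S^3=\{(x_1,x_2,x_3,x_4)\in\mathbf{R}^4:x_1^2+x_2^2-x_3^2-x_4^2=1\}\subset\Psi S^7$ (via $\mathbf{R}^4\subset\mathbf{C}^4=\mathbf{H}^2$) and $\Psi\mathbf{RP}^3=\Psi S^3/\{\pm1\}$, embedded in $\Psi\mathbf{CP}^3$ in the natural way. Let $\mathfrak{F}$ be the space of pairs $(e_1,e_2)$, $e_i\in\mathbf{H}^2$, with $\langle e_1,e_1\rangle=1$, $\langle e_2,e_2\rangle=-1$, $\langle e_1,e_2\rangle=0$ (a copy of $Sp(1,1)$),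 and $\mathtt{j}:\mathfrak{F}\to\Psi\mathbf{CP}^3$, $(e_1,e_2)\mapsto e_1\cdot S^1$. Define quaternion-valued $1$-forms $\phi^a_b$ on $\mathfrak{F}$ by $de_a=\sum_be_b\phi^b_a$, and real forms $\rho_1,\rho_2$ and complex forms $\omega_1,\omega_2,\omega_3,\tau$ by $$\begin{pmatrix}\phi^1_1&\phi^1_2\\ \phi^2_1&\phi^2_2\end{pmatrix}=\begin{pmatrix}i\rho_1+j\overline{\omega_3}&\overline{\omega_1}-j\omega_2\\ \omega_1+j\omega_2&i\rho_2+j\tau\end{pmatrix}.$$ The nearly Calabi-Yau structure on $\Psi\mathbf{CP}^3$ is the $SU(3)$-structure with $$\mathtt{j}^*\Omega=\tfrac{\sqrt{-1}}2\sum_{i=1}^3\omega_i\wedge\overline{\omega_i},\qquad\mathtt{j}^*\Psi=\omega_1\wedge\omega_2\wedge\omega_3,$$ and metric whose pullback is $\sum_i\omega_i\circ\overline{\omega_i}$. (Nearly Calabi-Yau means $d\Omega=d(\mathrm{Im}\,\Psi)=0$. The symbol $\Psi$ in $\Psi S^7,\Psi S^3,\Psi\mathbf{CP}^3,\Psi\mathbf{RP}^3$ is only a prefix meaning "pseudo" and is unrelated to the $3$-form $\Psi$.) A $3$-dimensional submanifold $L$ is special Lagrangian if, for one of its orientations, $\mathrm{Re}\,\Psi$ restricts to the volume form of $L$; for orientable $L$ this is equivalent to $\Omega|_L=\mathrm{Im}\,\Psi|_L=0$. *)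

theory Defs
  imports "HOL-Analysis.Analysis"
begin

section \<open>Smooth manifolds given by an atlas\<close>

text \<open>
  The libraries have no manifolds, so we introduce the few notions that are needed. A chart is a
  pair of a domain and a coordinate map, which is only meaningful on the domain.
\<close>

primrec Ck_on :: "nat \<Rightarrow> 'a::euclidean_space set \<Rightarrow> ('a \<Rightarrow> 'b::real_normed_vector) \<Rightarrow> bool" where
  "Ck_on 0 S f \<longleftrightarrow> continuous_on S f"
| "Ck_on (Suc k) S f \<longleftrightarrow>
     f differentiable_on S \<and> (\<forall>v. Ck_on k S (\<lambda>x. frechet_derivative f (at x) v))"

definition smooth_on :: "'a::euclidean_space set \<Rightarrow> ('a \<Rightarrow> 'b::real_normed_vector) \<Rightarrow> bool" where
  "smooth_on S f \<longleftrightarrow> open S \<and> (\<forall>k. Ck_on k S f)"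

type_synonym ('a, 'e) chart = "'a set \<times> ('a \<Rightarrow> 'e)"

definition mspace_of :: "('a, 'e) chart set \<Rightarrow> 'a set" where
  "mspace_of A = (\<Union>(U, \<phi>)\<in>A. U)"

definition mtopology_of :: "('a, 'e::euclidean_space) chart set \<Rightarrow> 'a topology" where
  "mtopology_of A =
     topology (\<lambda>O'. O' \<subseteq> mspace_of A \<and> (\<forall>(U, \<phi>)\<in>A. open (\<phi> ` (O' \<inter> U))))"

definition has_velocity ::
  "('a, 'e::euclidean_space) chart \<Rightarrow> (real \<Rightarrow> 'a) \<Rightarrow> 'e \<Rightarrow> bool" where
  "has_velocity d c w \<longleftrightarrow>
     (\<forall>\<^sub>F t in nhds 0. c t \<in> fst d) \<and> ((snd d \<circ> c) has_vector_derivative w) (at 0)"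

text \<open>
  A tangent vector at a point is an equivalence class of curves which pass through that point at
  time 0 and have the same velocity there in every chart around the point.
\<close>

type_synonym 'a tangent = "(real \<Rightarrow> 'a) set"

definition velocity :: "('a, 'e::euclidean_space) chart set \<Rightarrow> (real \<Rightarrow> 'a) \<Rightarrow> 'a tangent" where
  "velocity A c =
     {c'. c' 0 = c 0 \<and>
          (\<forall>d\<in>A. c 0 \<in> fst d \<longrightarrow> (\<exists>w. has_velocity d c w \<and> has_velocity d c' w))}"

section \<open>Embedded submanifolds and orientations\<close>

text \<open>
  A local parametrization of \<open>L\<close> is a smooth immersion of an open subset of a Euclidean space that
  is a homeomorphism onto a relatively open subset of \<open>L\<close> (in other words, the inverse of a chart
  of \<open>L\<close>).
\<close>

type_synonym ('a, 'n) param = "(real ^ 'n) set \<times> (real ^ 'n \<Rightarrow> 'a)"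

definition local_param ::
  "('a, 'e::euclidean_space) chart set \<Rightarrow> 'a set \<Rightarrow> ('a, 'n::finite) param \<Rightarrow> bool" where
  "local_param A L p \<longleftrightarrow> (case p of (W, r) \<Rightarrow>
     open W \<and> openin (subtopology (mtopology_of A) L) (r ` W) \<and>
     homeomorphic_map (top_of_set W) (subtopology (mtopology_of A) (r ` W)) r \<and>
     (\<forall>(U, \<phi>)\<in>A. smooth_on {u \<in> W. r u \<in> U} (\<phi> \<circ> r) \<and>
        (\<forall>u\<in>W. r u \<in> U \<longrightarrow> inj (frechet_derivative (\<phi> \<circ> r) (at u)))))"

definition embedded_submanifold ::
  "'n::finite itself \<Rightarrow> ('a, 'e::euclidean_space) chart set \<Rightarrow> 'a set \<Rightarrow> bool" where
  "embedded_submanifold _ A L \<longleftrightarrow> L \<subseteq> mspace_of A \<and>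
     (\<forall>x\<in>L. \<exists>p :: ('a, 'n) param. local_param A L p \<and> x \<in> snd p ` fst p)"

text \<open>
  An orientation of \<open>L\<close> is given by a family of local parametrizations that covers \<open>L\<close> and whose
  transition maps have positive Jacobian determinant.
\<close>

definition oriented_atlas ::
  "('a, 'e::euclidean_space) chart set \<Rightarrow> 'a set \<Rightarrow> ('a, 'n::finite) param set \<Rightarrow> bool" where
  "oriented_atlas A L P \<longleftrightarrow>
     (\<forall>p\<in>P. local_param A L p) \<and> L = (\<Union>(W, r)\<in>P. r ` W) \<and>
     (\<forall>(W, r)\<in>P. \<forall>(W', r')\<in>P. \<forall>u\<in>W. r u \<in> r' ` W' \<longrightarrow>
        det (matrix (frechet_derivative (inv_into W' r' \<circ> r) (at u))) > 0)"

definition coord_vector ::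
  "('a, 'e::euclidean_space) chart set \<Rightarrow> (real ^ 'n::finite \<Rightarrow> 'a) \<Rightarrow> real ^ 'n \<Rightarrow> 'n \<Rightarrow> 'a tangent"
  where "coord_vector A r u i = velocity A (\<lambda>t. r (u + t *\<^sub>R axis i 1))"

section \<open>Special Lagrangian submanifolds\<close>

text \<open>
  The structure tensors are evaluated on families of tangent vectors at a common point, indexed
  by \<open>2\<close> or \<open>3\<close>. The base point is part of a tangent vector.
\<close>

record 'a su3_structure =
  su3_metric :: "(2 \<Rightarrow> 'a tangent) \<Rightarrow> real"
  su3_Omega  :: "(2 \<Rightarrow> 'a tangent) \<Rightarrow> real"
  su3_Psi    :: "(3 \<Rightarrow> 'a tangent) \<Rightarrow> complex"

definition pair_family :: "'x \<Rightarrow> 'x \<Rightarrow> 2 \<Rightarrow> 'x" where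
  "pair_family x y i = (if i = 1 then x else y)"

text \<open>
  In positively oriented local coordinates the Riemannian volume form is
  \<open>sqrt (det g\<^sub>i\<^sub>j) du\<^sub>1 \<and> du\<^sub>2 \<and> du\<^sub>3\<close>; the following is its value on the coordinate vectors. Two
  \<open>3\<close>-forms on a \<open>3\<close>-manifold agree iff they agree on all coordinate vectors.
\<close>

definition volume_coeff ::
  "((2 \<Rightarrow> 'a tangent) \<Rightarrow> real) \<Rightarrow> ('n::finite \<Rightarrow> 'a tangent) \<Rightarrow> real" where
  "volume_coeff g X = sqrt (det (\<chi> i j. g (pair_family (X i) (X j)) :: real ^ 'n ^ 'n))"

definition special_lagrangian ::
  "('a, 'e::euclidean_space) chart set \<Rightarrow> 'a su3_structure \<Rightarrow> 'a set \<Rightarrow> bool" where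
  "special_lagrangian A S L \<longleftrightarrow>
     embedded_submanifold TYPE(3) A L \<and>
     (\<exists>P. oriented_atlas A L P \<and>
        (\<forall>(W, r)\<in>P. \<forall>u\<in>W.
           Re (su3_Psi S (coord_vector A r u)) = volume_coeff (su3_metric S) (coord_vector A r u)))"

section \<open>Quaternions and the pseudo-Hermitian quaternionic plane\<close>

text \<open>
  The pair \<open>(z, w)\<close> stands for the quaternion \<open>z + j w\<close>, with \<open>j\<^sup>2 = -1\<close> and
  \<open>z j = j (cnj z)\<close>. Accordingly \<open>((z1, z2), (z3, z4))\<close> is both a vector of \<open>\<complex>\<^sup>4\<close> and the vector
  \<open>(z1 + j z2, z3 + j z4)\<close> of \<open>H\<^sup>2\<close>.
\<close>

type_synonym quat = "complex \<times> complex"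
type_synonym H2 = "quat \<times> quat"

definition qmult :: "quat \<Rightarrow> quat \<Rightarrow> quat" where
  "qmult p q = (fst p * fst q - cnj (snd p) * snd q, snd p * fst q + cnj (fst p) * snd q)"

definition qcnj :: "quat \<Rightarrow> quat" where
  "qcnj q = (cnj (fst q), - snd q)"

definition qone :: quat where
  "qone = (1, 0)"

definition rscale :: "H2 \<Rightarrow> quat \<Rightarrow> H2" where
  "rscale x a = (qmult (fst x) a, qmult (snd x) a)"

definition hprod :: "H2 \<Rightarrow> H2 \<Rightarrow> quat" where
  "hprod x y = qmult (qcnj (fst x)) (fst y) - qmult (qcnj (snd x)) (snd y)"

section \<open>The pseudo-projective spaces\<close>

definition PsiS7 :: "H2 set" where
  "PsiS7 = {(p, q). qmult (qcnj p) p - qmult (qcnj q) q = qone}"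

definition circle_orbit :: "H2 \<Rightarrow> H2 set" where
  "circle_orbit x = {rscale x (u, 0) | u. cmod u = 1}"

definition PsiCP3 :: "H2 set set" where
  "PsiCP3 = circle_orbit ` PsiS7"

text \<open>
  The circle acts on \<open>\<complex>\<^sup>4\<close> by ordinary scalar multiplication, so that \<open>PsiCP3\<close> is an open subset of
  complex projective space, with the usual affine coordinates. The first two affine charts cover
  it because \<open>\<bar>z1\<bar>\<^sup>2 + \<bar>z2\<bar>\<^sup>2 > 0\<close> on \<open>PsiS7\<close>. The coordinates do not depend on the element
  of the orbit, which is why \<open>the_elem\<close> may be used.
\<close>

definition affine1 :: "H2 \<Rightarrow> complex \<times> complex \<times> complex" where
  "affine1 = (\<lambda>((z1, z2), (z3, z4)). (z2 / z1, z3 / z1, z4 / z1))"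

definition affine2 :: "H2 \<Rightarrow> complex \<times> complex \<times> complex" where
  "affine2 = (\<lambda>((z1, z2), (z3, z4)). (z1 / z2, z3 / z2, z4 / z2))"

definition PsiCP3_atlas :: "(H2 set, complex \<times> complex \<times> complex) chart set" where
  "PsiCP3_atlas =
     {(circle_orbit ` {x \<in> PsiS7. fst (fst x) \<noteq> 0}, \<lambda>Q. the_elem (affine1 ` Q)),
      (circle_orbit ` {x \<in> PsiS7. snd (fst x) \<noteq> 0}, \<lambda>Q. the_elem (affine2 ` Q))}"

definition PsiS3 :: "H2 set" where
  "PsiS3 = {((of_real x1, of_real x2), (of_real x3, of_real x4)) | x1 x2 x3 x4 :: real.
              x1\<^sup>2 + x2\<^sup>2 - x3\<^sup>2 - x4\<^sup>2 = 1}"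

definition PsiRP3 :: "H2 set set" where
  "PsiRP3 = (\<lambda>x. {x, - x}) ` PsiS3"

text \<open>The natural map from \<open>PsiRP3\<close> to \<open>PsiCP3\<close> sends \<open>{x, - x}\<close> to the circle orbit of \<open>x\<close>.\<close>

definition PsiRP3_incl :: "H2 set \<Rightarrow> H2 set" where
  "PsiRP3_incl Q = \<Union> (circle_orbit ` Q)"

section \<open>The frame space and the SU(3)-structure\<close>

text \<open>An element \<open>e\<close> of \<open>frames\<close> has the components \<open>e $ 1\<close> and \<open>e $ 2\<close>.\<close>

definition frames :: "(H2 ^ 2) set" where
  "frames = {e. hprod (e $ 1) (e $ 1) = qone \<and> hprod (e $ 2) (e $ 2) = - qone \<and>
               hprod (e $ 1) (e $ 2) = 0}"

definition frame_proj :: "H2 ^ 2 \<Rightarrow> H2 set" where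
  "frame_proj e = circle_orbit (e $ 1)"

text \<open>
  \<open>mc_form e v $ b $ a\<close> is the form \<open>\<phi>\<^sup>b\<^sub>a\<close> at the frame \<open>e\<close>, evaluated on the tangent
  vector \<open>v\<close>, where \<open>de\<^sub>a (v) = v $ a\<close>.
\<close>

definition mc_form :: "H2 ^ 2 \<Rightarrow> H2 ^ 2 \<Rightarrow> quat ^ 2 ^ 2" where
  "mc_form e v = (THE \<phi>. \<forall>a. v $ a = (\<Sum>b\<in>UNIV. rscale (e $ b) (\<phi> $ b $ a)))"

text \<open>
  Read off from \<open>\<phi>\<^sup>2\<^sub>1 = \<omega>\<^sub>1 + j \<omega>\<^sub>2\<close> and \<open>\<phi>\<^sup>1\<^sub>1 = i \<rho>\<^sub>1 + j (cnj \<omega>\<^sub>3)\<close>.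
\<close>

definition omega :: "H2 ^ 2 \<Rightarrow> H2 ^ 2 \<Rightarrow> complex ^ 3" where
  "omega e v = vector [fst (mc_form e v $ 2 $ 1), snd (mc_form e v $ 2 $ 1),
                       cnj (snd (mc_form e v $ 1 $ 1))]"

text \<open>
  The tensors on the frame space. The wedge product is normalized without factorials,
  \<open>(\<alpha> \<and> \<beta>)(v, w) = \<alpha> v * \<beta> w - \<alpha> w * \<beta> v\<close>, and the symmetric product is
  \<open>(\<alpha> \<circ> \<beta>)(v, w) = (\<alpha> v * \<beta> w + \<alpha> w * \<beta> v) / 2\<close>. The expressions below \<open>Re\<close> are real.
\<close>

definition frame_metric :: "H2 ^ 2 \<Rightarrow> (2 \<Rightarrow> H2 ^ 2) \<Rightarrow> real" where
  "frame_metric e v =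
     Re (\<Sum>i\<in>UNIV. (omega e (v 1) $ i * cnj (omega e (v 2) $ i)
                + omega e (v 2) $ i * cnj (omega e (v 1) $ i)) / 2)"

definition frame_Omega :: "H2 ^ 2 \<Rightarrow> (2 \<Rightarrow> H2 ^ 2) \<Rightarrow> real" where
  "frame_Omega e v =
     Re (\<i> / 2 * (\<Sum>i\<in>UNIV. omega e (v 1) $ i * cnj (omega e (v 2) $ i)
                       - omega e (v 2) $ i * cnj (omega e (v 1) $ i)))"

definition frame_Psi :: "H2 ^ 2 \<Rightarrow> (3 \<Rightarrow> H2 ^ 2) \<Rightarrow> complex" where
  "frame_Psi e v = det (\<chi> i j. omega e (v j) $ i)"

definition frame_curve :: "H2 ^ 2 \<Rightarrow> (real \<Rightarrow> H2 ^ 2) \<Rightarrow> H2 ^ 2 \<Rightarrow> bool" where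
  "frame_curve e \<gamma> v \<longleftrightarrow>
     \<gamma> 0 = e \<and> (\<forall>t. \<gamma> t \<in> frames) \<and> (\<gamma> has_vector_derivative v) (at 0)"

text \<open>
  The tensor on \<open>PsiCP3\<close> whose pullback along the submersion \<open>frame_proj\<close> is \<open>\<eta>\<close>: its value on
  tangent vectors is the value of \<open>\<eta>\<close> on any lifts of them to a common frame.
\<close>

definition descend ::
  "(H2 ^ 2 \<Rightarrow> ('i \<Rightarrow> H2 ^ 2) \<Rightarrow> 'b) \<Rightarrow> ('i \<Rightarrow> H2 set tangent) \<Rightarrow> 'b" where
  "descend \<eta> X = (THE y. \<exists>e\<in>frames. \<exists>\<gamma> v.
     (\<forall>i. frame_curve e (\<gamma> i) (v i) \<and> X i = velocity PsiCP3_atlas (frame_proj \<circ> \<gamma> i)) \<and>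
     y = \<eta> e v)"

definition PsiCP3_su3 :: "H2 set su3_structure" where
  "PsiCP3_su3 = \<lparr> su3_metric = descend frame_metric, su3_Omega = descend frame_Omega,
                 su3_Psi = descend frame_Psi \<rparr>"

section \<open>The SU(3)-structure is well defined\<close>

text \<open>
  The remaining facts show that the descriptions in \<open>descend\<close> are proper: \<open>frames\<close> consists of
  bases, lifts of the same tangent vectors have forms \<open>\<omega>\<^sub>i\<close> that differ by an element of SU(3), and
  therefore \<open>PsiCP3_su3\<close> has the prescribed pullbacks (\<open>pullback_Psi\<close>, \<open>pullback_metric\<close>,
  \<open>pullback_Omega\<close>).
\<close>

lemmas qdefs = qmult_def qcnj_def qone_def rscale_def hprod_def

lemma hprod_add: "hprod x (y + z) = hprod x y + hprod x z"
  by (auto simp: qdefs prod_eq_iff algebra_simps)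

lemma hprod_rscale: "hprod x (rscale y a) = qmult (hprod x y) a"
  by (auto simp: qdefs prod_eq_iff algebra_simps)

lemma hprod_rscale_left: "hprod (rscale x a) y = qmult (qcnj a) (hprod x y)"
  by (auto simp: qdefs prod_eq_iff algebra_simps)

lemma hprod_swap: "hprod y x = qcnj (hprod x y)"
  by (auto simp: qdefs prod_eq_iff algebra_simps)

lemma qmult_simps [simp]: "qmult qone a = a" "qmult a qone = a" "qmult 0 a = 0" "qmult a 0 = 0"
   "qmult (- a) b = - qmult a b" "qmult a (- b) = - qmult a b" "qcnj 0 = 0" "qcnj qone = qone"
   "qcnj (- a) = - qcnj a"
  by (auto simp: qdefs prod_eq_iff)

lemma rscale_one [simp]: "rscale x qone = x" "rscale x 0 = 0" by (auto simp: qdefs prod_eq_iff)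

lemma frame_expand:
  assumes "e \<in> frames"
  shows "x = rscale (e$1) (hprod (e$1) x) + rscale (e$2) (- hprod (e$2) x)"
proof -
  let ?L = "\<lambda>c. rscale (e$1) (fst c) + rscale (e$2) (snd c)"
  have h: "hprod (e$1) (e$1) = qone" "hprod (e$2) (e$2) = - qone" "hprod (e$1) (e$2) = 0"
    "hprod (e$2) (e$1) = 0"
    using assms hprod_swap[of "e$2" "e$1"] by (auto simp: frames_def)
  have k: "hprod (e$1) (?L c) = fst c" "hprod (e$2) (?L c) = - snd c" for c
    by (simp_all add: hprod_add hprod_rscale h)
  have "linear ?L"
    by (rule linearI) (auto simp: qdefs prod_eq_iff algebra_simps scaleR_conv_of_real)
  moreover have "inj ?L"
    by (rule injI) (metis k neg_equal_iff_equal prod_eq_iff)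
  ultimately have "surj ?L" by (rule linear_inj_imp_surj)
  then obtain c where "x = ?L c" by (rule surjE)
  then show ?thesis using k[of c] by simp
qed

lemma mc_form_eq:
  assumes "e \<in> frames"
  shows "mc_form e v $ 1 $ a = hprod (e$1) (v$a)" "mc_form e v $ 2 $ a = - hprod (e$2) (v$a)"
proof -
  have h: "hprod (e$1) (e$1) = qone" "hprod (e$2) (e$2) = - qone" "hprod (e$1) (e$2) = 0"
    "hprod (e$2) (e$1) = 0"
    using assms hprod_swap[of "e$2" "e$1"] by (auto simp: frames_def)
  let ?f = "(\<chi> b a. if b = 1 then hprod (e$1) (v$a) else - hprod (e$2) (v$a)) :: quat^2^2"
  have "mc_form e v = ?f"
    unfolding mc_form_def
  proof (rule the_equality)
    show "\<forall>a. v $ a = (\<Sum>b\<in>UNIV. rscale (e $ b) (?f $ b $ a))"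
      using frame_expand[OF assms] by (simp add: sum_2)
    fix f :: "quat^2^2" assume f: "\<forall>a. v $ a = (\<Sum>b\<in>UNIV. rscale (e $ b) (f $ b $ a))"
    show "f = ?f"
      unfolding vec_eq_iff using f
      by (auto simp: forall_2 sum_2 hprod_add hprod_rscale h)
  qed
  then show "mc_form e v $ 1 $ a = hprod (e$1) (v$a)" "mc_form e v $ 2 $ a = - hprod (e$2) (v$a)"
    by auto
qed

lemma elem1: assumes "x \<in> PsiS7" "fst (fst x) \<noteq> 0" shows "the_elem (affine1 ` circle_orbit x) = affine1 x"
proof -
  have "affine1 ` circle_orbit x = {affine1 x}"
  proof -
    have "affine1 (rscale x (u,0)) = affine1 x" if "cmod u = 1" for u
      using that assms by (auto simp: affine1_def qdefs split: prod.splits)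
    moreover have "rscale x (1,0) = x" using rscale_one[of x] by (simp add: qone_def)
    ultimately show ?thesis unfolding circle_orbit_def by (force intro: exI[of _ 1])
  qed
  then show ?thesis by simp
qed

lemma elem2: assumes "x \<in> PsiS7" "snd (fst x) \<noteq> 0" shows "the_elem (affine2 ` circle_orbit x) = affine2 x"
proof -
  have "affine2 ` circle_orbit x = {affine2 x}"
  proof -
    have "affine2 (rscale x (u,0)) = affine2 x" if "cmod u = 1" for u
      using that assms by (auto simp: affine2_def qdefs split: prod.splits)
    moreover have "rscale x (1,0) = x" using rscale_one[of x] by (simp add: qone_def)
    ultimately show ?thesis unfolding circle_orbit_def by (force intro: exI[of _ 1])
  qed
  then show ?thesis by simp
qed

lemma frame_S7: "e \<in> frames \<Longrightarrow> e$1 \<in> PsiS7"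
  by (auto simp: frames_def PsiS7_def hprod_def split: prod.splits)

lemma S7_ne: "x \<in> PsiS7 \<Longrightarrow> fst (fst x) \<noteq> 0 \<or> snd (fst x) \<noteq> 0"
proof (rule ccontr)
  assume a: "x \<in> PsiS7" and "\<not> (fst (fst x) \<noteq> 0 \<or> snd (fst x) \<noteq> 0)"
  then obtain c d where x: "x = ((0,0),(c,d))" by (metis prod.collapse)
  have "- (cnj c * c + cnj d * d) = 1" using a by (auto simp: x PsiS7_def qdefs)
  then have "- complex_of_real ((cmod c)^2 + (cmod d)^2) = 1"
    by (metis complex_norm_square mult.commute of_real_add)
  then have "- ((cmod c)^2 + (cmod d)^2) = 1"
    by (metis of_real_eq_1_iff of_real_minus)
  then show False by (smt (verit) zero_le_power2)
qed

lemma deriv1: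
  assumes c: "frame_curve e \<gamma> v" and n: "fst (fst (e$1)) \<noteq> 0"
    and e: "e$1 = ((z1,z2),(z3,z4))" and v: "v$1 = ((a1,a2),(a3,a4))"
  shows "has_velocity (circle_orbit ` {x \<in> PsiS7. fst (fst x) \<noteq> 0}, \<lambda>Q. the_elem (affine1 ` Q))
    (frame_proj \<circ> \<gamma>) ((a2*z1-z2*a1)/z1^2,(a3*z1-z3*a1)/z1^2,(a4*z1-z4*a1)/z1^2)"
proof -
  have g0: "\<gamma> 0 = e" and gF: "\<And>t. \<gamma> t \<in> frames" and gd: "(\<gamma> has_vector_derivative v) (at 0)"
    using c by (auto simp: frame_curve_def)
  have g1: "((\<lambda>t. \<gamma> t $ 1) has_vector_derivative ((a1,a2),(a3,a4))) (at 0)"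
    using bounded_linear.has_vector_derivative[OF bounded_linear_vec_nth gd, of 1] v by metis
  note bl = bounded_linear.has_vector_derivative[OF bounded_linear_fst] bounded_linear.has_vector_derivative[OF bounded_linear_snd]
  have p: "((\<lambda>t. fst (fst (\<gamma> t $ 1))) has_vector_derivative a1) (at 0)"
    "((\<lambda>t. snd (fst (\<gamma> t $ 1))) has_vector_derivative a2) (at 0)"
    "((\<lambda>t. fst (snd (\<gamma> t $ 1))) has_vector_derivative a3) (at 0)"
    "((\<lambda>t. snd (snd (\<gamma> t $ 1))) has_vector_derivative a4) (at 0)"
    using bl(1)[OF bl(1)[OF g1]] bl(2)[OF bl(1)[OF g1]] bl(1)[OF bl(2)[OF g1]] bl(2)[OF bl(2)[OF g1]] by auto
  have "isCont (\<lambda>t. fst (fst (\<gamma> t $ 1))) 0" using p(1) has_vector_derivative_continuous by blast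
  then have "((\<lambda>t. fst (fst (\<gamma> t $ 1))) \<longlongrightarrow> fst (fst (\<gamma> 0 $ 1))) (nhds 0)"
    by (metis isCont_def tendsto_at_iff_tendsto_nhds)
  then have ev: "\<forall>\<^sub>F t in nhds 0. fst (fst (\<gamma> t $ 1)) \<noteq> 0"
    using n g0 tendsto_imp_eventually_ne by metis
  have q: "((\<lambda>t. f t / fst (fst (\<gamma> t $ 1))) has_vector_derivative (a * z1 - f 0 * a1) / z1^2) (at 0)"
    if "(f has_vector_derivative a) (at 0)" for f a
  proof -
    have "((\<lambda>t. f t / fst (fst (\<gamma> t $ 1))) has_derivative
       (\<lambda>t. - f 0 * (inverse z1 * (t *\<^sub>R a1) * inverse z1) + (t *\<^sub>R a) / z1)) (at 0)"
      using has_derivative_divide[OF that[unfolded has_vector_derivative_def] p(1)[unfolded has_vector_derivative_def]] n g0 e by simp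
    moreover have "(\<lambda>t. - f 0 * (inverse z1 * (t *\<^sub>R a1) * inverse z1) + (t *\<^sub>R a) / z1) = (\<lambda>t. t *\<^sub>R ((a * z1 - f 0 * a1) / z1^2))"
      using n e by (auto simp: field_simps power2_eq_square scaleR_conv_of_real)
    ultimately show ?thesis by (simp add: has_vector_derivative_def)
  qed
  have d: "((\<lambda>t. affine1 (\<gamma> t $ 1)) has_vector_derivative ((a2*z1-z2*a1)/z1^2,(a3*z1-z3*a1)/z1^2,(a4*z1-z4*a1)/z1^2)) (at 0)"
    unfolding affine1_def case_prod_beta
    using has_vector_derivative_Pair[OF q[OF p(2)] has_vector_derivative_Pair[OF q[OF p(3)] q[OF p(4)]]] g0 e
    by simp
  have "\<forall>\<^sub>F t in nhds 0. affine1 (\<gamma> t $ 1) = ((\<lambda>Q. the_elem (affine1 ` Q)) \<circ> (frame_proj \<circ> \<gamma>)) t"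
    using ev by eventually_elim (simp add: frame_proj_def elem1 frame_S7 gF)
  then have "(((\<lambda>Q. the_elem (affine1 ` Q)) \<circ> (frame_proj \<circ> \<gamma>)) has_vector_derivative ((a2*z1-z2*a1)/z1^2,(a3*z1-z3*a1)/z1^2,(a4*z1-z4*a1)/z1^2)) (at 0)"
    using d by (subst has_vector_derivative_cong_ev[symmetric, where f="\<lambda>t. affine1 (\<gamma> t $ 1)"])
     (auto elim: eventually_mono dest: eventually_nhds_x_imp_x)
  moreover have "\<forall>\<^sub>F t in nhds 0. (frame_proj \<circ> \<gamma>) t \<in> circle_orbit ` {x \<in> PsiS7. fst (fst x) \<noteq> 0}"
    using ev by eventually_elim (auto simp: frame_proj_def frame_S7 gF)
  ultimately show ?thesis by (simp add: has_velocity_def)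
qed

lemma deriv2:
  assumes c: "frame_curve e \<gamma> v" and n: "snd (fst (e$1)) \<noteq> 0"
    and e: "e$1 = ((z1,z2),(z3,z4))" and v: "v$1 = ((a1,a2),(a3,a4))"
  shows "has_velocity (circle_orbit ` {x \<in> PsiS7. snd (fst x) \<noteq> 0}, \<lambda>Q. the_elem (affine2 ` Q))
    (frame_proj \<circ> \<gamma>) ((a1*z2-z1*a2)/z2^2,(a3*z2-z3*a2)/z2^2,(a4*z2-z4*a2)/z2^2)"
proof -
  have g0: "\<gamma> 0 = e" and gF: "\<And>t. \<gamma> t \<in> frames" and gd: "(\<gamma> has_vector_derivative v) (at 0)"
    using c by (auto simp: frame_curve_def)
  have g1: "((\<lambda>t. \<gamma> t $ 1) has_vector_derivative ((a1,a2),(a3,a4))) (at 0)"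
    using bounded_linear.has_vector_derivative[OF bounded_linear_vec_nth gd, of 1] v by metis
  note bl = bounded_linear.has_vector_derivative[OF bounded_linear_fst] bounded_linear.has_vector_derivative[OF bounded_linear_snd]
  have p: "((\<lambda>t. fst (fst (\<gamma> t $ 1))) has_vector_derivative a1) (at 0)"
    "((\<lambda>t. snd (fst (\<gamma> t $ 1))) has_vector_derivative a2) (at 0)"
    "((\<lambda>t. fst (snd (\<gamma> t $ 1))) has_vector_derivative a3) (at 0)"
    "((\<lambda>t. snd (snd (\<gamma> t $ 1))) has_vector_derivative a4) (at 0)"
    using bl(1)[OF bl(1)[OF g1]] bl(2)[OF bl(1)[OF g1]] bl(1)[OF bl(2)[OF g1]] bl(2)[OF bl(2)[OF g1]] by auto
  have "isCont (\<lambda>t. snd (fst (\<gamma> t $ 1))) 0" using p(2) has_vector_derivative_continuous by blast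
  then have "((\<lambda>t. snd (fst (\<gamma> t $ 1))) \<longlongrightarrow> snd (fst (\<gamma> 0 $ 1))) (nhds 0)"
    by (metis isCont_def tendsto_at_iff_tendsto_nhds)
  then have ev: "\<forall>\<^sub>F t in nhds 0. snd (fst (\<gamma> t $ 1)) \<noteq> 0"
    using n g0 tendsto_imp_eventually_ne by metis
  have q: "((\<lambda>t. f t / snd (fst (\<gamma> t $ 1))) has_vector_derivative (a * z2 - f 0 * a2) / z2^2) (at 0)"
    if "(f has_vector_derivative a) (at 0)" for f a
  proof -
    have "((\<lambda>t. f t / snd (fst (\<gamma> t $ 1))) has_derivative
       (\<lambda>t. - f 0 * (inverse z2 * (t *\<^sub>R a2) * inverse z2) + (t *\<^sub>R a) / z2)) (at 0)"
      using has_derivative_divide[OF that[unfolded has_vector_derivative_def] p(2)[unfolded has_vector_derivative_def]] n g0 e by simp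
    moreover have "(\<lambda>t. - f 0 * (inverse z2 * (t *\<^sub>R a2) * inverse z2) + (t *\<^sub>R a) / z2) = (\<lambda>t. t *\<^sub>R ((a * z2 - f 0 * a2) / z2^2))"
      using n e by (auto simp: field_simps power2_eq_square scaleR_conv_of_real)
    ultimately show ?thesis by (simp add: has_vector_derivative_def)
  qed
  have d: "((\<lambda>t. affine2 (\<gamma> t $ 1)) has_vector_derivative ((a1*z2-z1*a2)/z2^2,(a3*z2-z3*a2)/z2^2,(a4*z2-z4*a2)/z2^2)) (at 0)"
    unfolding affine2_def case_prod_beta
    using has_vector_derivative_Pair[OF q[OF p(1)] has_vector_derivative_Pair[OF q[OF p(3)] q[OF p(4)]]] g0 e
    by simp
  have "\<forall>\<^sub>F t in nhds 0. affine2 (\<gamma> t $ 1) = ((\<lambda>Q. the_elem (affine2 ` Q)) \<circ> (frame_proj \<circ> \<gamma>)) t"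
    using ev by eventually_elim (simp add: frame_proj_def elem2 frame_S7 gF)
  then have "(((\<lambda>Q. the_elem (affine2 ` Q)) \<circ> (frame_proj \<circ> \<gamma>)) has_vector_derivative ((a1*z2-z1*a2)/z2^2,(a3*z2-z3*a2)/z2^2,(a4*z2-z4*a2)/z2^2)) (at 0)"
    using d by (subst has_vector_derivative_cong_ev[symmetric, where f="\<lambda>t. affine2 (\<gamma> t $ 1)"])
     (auto elim: eventually_mono dest: eventually_nhds_x_imp_x)
  moreover have "\<forall>\<^sub>F t in nhds 0. (frame_proj \<circ> \<gamma>) t \<in> circle_orbit ` {x \<in> PsiS7. snd (fst x) \<noteq> 0}"
    using ev by eventually_elim (auto simp: frame_proj_def frame_S7 gF)
  ultimately show ?thesis by (simp add: has_velocity_def)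
qed

lemma orbit_eqD:
  assumes "circle_orbit x = circle_orbit y"
  obtains u where "cmod u = 1" "y = rscale x (u,0)"
proof -
  have "y \<in> circle_orbit y" using rscale_one[of y] unfolding circle_orbit_def qone_def
    by (metis (mono_tags, lifting) mem_Collect_eq norm_one)
  then show ?thesis using assms that unfolding circle_orbit_def by blast
qed

lemma velocity_base:
  assumes e: "e \<in> frames" and c: "frame_curve e \<gamma> v" "frame_curve e' \<gamma>' v'"
   and eq: "velocity PsiCP3_atlas (frame_proj \<circ> \<gamma>) = velocity PsiCP3_atlas (frame_proj \<circ> \<gamma>')"
  shows "frame_proj e = frame_proj e'" "\<And>d. d \<in> PsiCP3_atlas \<Longrightarrow> frame_proj e \<in> fst d \<Longrightarrow>
     \<exists>w. has_velocity d (frame_proj \<circ> \<gamma>) w \<and> has_velocity d (frame_proj \<circ> \<gamma>') w"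
proof -
  obtain z1 z2 z3 z4 where z: "e$1 = ((z1,z2),(z3,z4))" by (metis prod.collapse)
  obtain a1 a2 a3 a4 where a: "v$1 = ((a1,a2),(a3,a4))" by (metis prod.collapse)
  have g0: "\<gamma> 0 = e" "\<gamma>' 0 = e'" using c by (auto simp: frame_curve_def)
  let ?U1 = "circle_orbit ` {x \<in> PsiS7. fst (fst x) \<noteq> 0}" and ?U2 = "circle_orbit ` {x \<in> PsiS7. snd (fst x) \<noteq> 0}"
  let ?d1 = "(?U1, \<lambda>Q. the_elem (affine1 ` Q))" and ?d2 = "(?U2, \<lambda>Q. the_elem (affine2 ` Q))"
    have "z1 = 0 \<Longrightarrow> frame_proj e \<in> ?U1 \<Longrightarrow> False"
    proof -
      assume "z1 = 0" "frame_proj e \<in> ?U1"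
      then obtain x where "fst (fst x) \<noteq> 0" "circle_orbit x = circle_orbit (e$1)" by (auto simp: frame_proj_def)
      then obtain s where "cmod s = 1" "e$1 = rscale x (s,0)" by (metis orbit_eqD)
      then show False using \<open>fst (fst x) \<noteq> 0\<close> \<open>z1 = 0\<close> z by (cases x) (auto simp: qdefs)
    qed
    moreover have "z2 = 0 \<Longrightarrow> frame_proj e \<in> ?U2 \<Longrightarrow> False"
    proof -
      assume "z2 = 0" "frame_proj e \<in> ?U2"
      then obtain x where "snd (fst x) \<noteq> 0" "circle_orbit x = circle_orbit (e$1)" by (auto simp: frame_proj_def)
      then obtain s where "cmod s = 1" "e$1 = rscale x (s,0)" by (metis orbit_eqD)
      then show False using \<open>snd (fst x) \<noteq> 0\<close> \<open>z2 = 0\<close> z by (cases x) (auto simp: qdefs)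
    qed
    ultimately have "frame_proj \<circ> \<gamma> \<in> velocity PsiCP3_atlas (frame_proj \<circ> \<gamma>)"
      using deriv1[OF c(1) _ z a] deriv2[OF c(1) _ z a] z g0
      by (auto simp: velocity_def PsiCP3_atlas_def)

  then have "frame_proj \<circ> \<gamma> \<in> velocity PsiCP3_atlas (frame_proj \<circ> \<gamma>')" using eq by simp
  then have *: "frame_proj e = frame_proj e'" "\<forall>d \<in> PsiCP3_atlas. frame_proj e' \<in> fst d \<longrightarrow>
     (\<exists>w. has_velocity d (frame_proj \<circ> \<gamma>') w \<and> has_velocity d (frame_proj \<circ> \<gamma>) w)"
      unfolding velocity_def by (simp_all add: g0)
  show "frame_proj e = frame_proj e'" by (rule *)
  show "\<exists>w. has_velocity d (frame_proj \<circ> \<gamma>) w \<and> has_velocity d (frame_proj \<circ> \<gamma>') w"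
    if "d \<in> PsiCP3_atlas" "frame_proj e \<in> fst d" for d using * that by metis
qed

lemma velocity_eqD:
  assumes e: "e \<in> frames" "e' \<in> frames" and c: "frame_curve e \<gamma> v" "frame_curve e' \<gamma>' v'"
   and eq: "velocity PsiCP3_atlas (frame_proj \<circ> \<gamma>) = velocity PsiCP3_atlas (frame_proj \<circ> \<gamma>')"
   and e1: "e' $ 1 = rscale (e$1) (u,0)" and u: "cmod u = 1"
  shows "\<exists>c. v' $ 1 = rscale (v$1) (u,0) + rscale (e$1) (c,0)"
proof -
  obtain z1 z2 z3 z4 where z: "e$1 = ((z1,z2),(z3,z4))" by (metis prod.collapse)
  obtain a1 a2 a3 a4 where a: "v$1 = ((a1,a2),(a3,a4))" by (metis prod.collapse)
  obtain b1 b2 b3 b4 where b: "v'$1 = ((b1,b2),(b3,b4))" by (metis prod.collapse)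
  have z': "e'$1 = ((z1*u,z2*u),(z3*u,z4*u))" using e1 z by (simp add: qdefs)
  have u0: "u \<noteq> 0" using u by auto
  let ?U1 = "circle_orbit ` {x \<in> PsiS7. fst (fst x) \<noteq> 0}" and ?U2 = "circle_orbit ` {x \<in> PsiS7. snd (fst x) \<noteq> 0}"
  let ?d1 = "(?U1, \<lambda>Q. the_elem (affine1 ` Q))" and ?d2 = "(?U2, \<lambda>Q. the_elem (affine2 ` Q))"
  note A = velocity_base(2)[OF e(1) c eq]
  have uniq: "w = w'" if "has_velocity d q w" "has_velocity d q w'" for d :: "(H2 set, complex \<times> complex \<times> complex) chart" and q w w'
    using that vector_derivative_unique_at by (auto simp: has_velocity_def)
  have alg: "b = a * u + z * ((b0 - a0 * u) / z0)"
    if "(b * (z0*u) - (z*u) * b0) / (z0*u)^2 = (a * z0 - z * a0) / z0^2" "z0 \<noteq> 0" for a b z a0 b0 z0 :: complex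
  proof -
    have "(b * (z0*u) - (z*u) * b0) * z0^2 = (a * z0 - z * a0) * (z0*u)^2" using that u0 by (simp add: field_simps)
    then have "(b * z0 - z * b0) * (u * z0^2) = ((a * z0 - z * a0) * u) * (u * z0^2)" by (simp add: algebra_simps power2_eq_square)
    then have "b * z0 - z * b0 = (a * z0 - z * a0) * u" using u0 that by simp
    then show ?thesis using that by (simp add: field_simps)
  qed
  show ?thesis
  proof (cases "z1 = 0")
    case False
    then have "frame_proj e \<in> ?U1" using z frame_S7[OF e(1)] by (auto simp: frame_proj_def intro!: imageI)
    then obtain w where w: "has_velocity ?d1 (frame_proj \<circ> \<gamma>) w" "has_velocity ?d1 (frame_proj \<circ> \<gamma>') w"
      using A[of ?d1] by (auto simp: PsiCP3_atlas_def)
    have "(b2*(z1*u)-(z2*u)*b1)/(z1*u)^2 = (a2*z1-z2*a1)/z1^2" "(b3*(z1*u)-(z3*u)*b1)/(z1*u)^2 = (a3*z1-z3*a1)/z1^2"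
       "(b4*(z1*u)-(z4*u)*b1)/(z1*u)^2 = (a4*z1-z4*a1)/z1^2"
      using uniq[OF w(1) deriv1[OF c(1) _ z a]] uniq[OF w(2) deriv1[OF c(2) _ z' b]] z z' u0 False by auto
    note r = this[THEN alg, OF False]
    show ?thesis
      by (rule exI[of _ "(b1 - a1*u)/z1"], use False r in \<open>simp add: a b z qdefs\<close>)
  next
    case True
    then have n: "z2 \<noteq> 0" using S7_ne[OF frame_S7[OF e(1)]] z by simp
    then have "frame_proj e \<in> ?U2" using z frame_S7[OF e(1)] by (auto simp: frame_proj_def intro!: imageI)
    then obtain w where w: "has_velocity ?d2 (frame_proj \<circ> \<gamma>) w" "has_velocity ?d2 (frame_proj \<circ> \<gamma>') w"
      using A[of ?d2] by (auto simp: PsiCP3_atlas_def)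
    have "(b1*(z2*u)-(z1*u)*b2)/(z2*u)^2 = (a1*z2-z1*a2)/z2^2" "(b3*(z2*u)-(z3*u)*b2)/(z2*u)^2 = (a3*z2-z3*a2)/z2^2"
       "(b4*(z2*u)-(z4*u)*b2)/(z2*u)^2 = (a4*z2-z4*a2)/z2^2"
      using uniq[OF w(1) deriv2[OF c(1) _ z a]] uniq[OF w(2) deriv2[OF c(2) _ z' b]] z z' u0 n by auto
    note r = this[THEN alg, OF n]
    show ?thesis
      by (rule exI[of _ "(b2 - a2*u)/z2"], use n r in \<open>simp add: a b z qdefs\<close>)
  qed
qed

lemma omega_change:
  assumes e: "e \<in> frames" "e' \<in> frames" and e1: "e' $ 1 = rscale (e$1) (u,0)" and u: "cmod u = 1"
  shows "\<exists>a b. a * cnj a + b * cnj b = 1 \<and> (\<forall>v v' c. v' $ 1 = rscale (v$1) (u,0) + rscale (e$1) (c,0) \<longrightarrow>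
     omega e' v' $ 1 = (a * omega e v $ 1 - cnj b * omega e v $ 2) * u \<and>
     omega e' v' $ 2 = (b * omega e v $ 1 + cnj a * omega e v $ 2) * u \<and>
     omega e' v' $ 3 = cnj u * cnj u * omega e v $ 3)"
proof -
  have uu: "u * cnj u = 1" using u by (simp add: complex_norm_square[symmetric])
  have uu': "u * (cnj u * x) = x" for x using uu by (metis mult.assoc mult_1)
  have h: "hprod (e$1) (e$1) = qone" "hprod (e$2) (e$2) = - qone" "hprod (e$1) (e$2) = 0"
    "hprod (e$2) (e$1) = 0"
    using e hprod_swap[of "e$2" "e$1"] by (auto simp: frames_def)
  have h': "hprod (e'$1) (e'$2) = 0" "hprod (e'$2) (e'$2) = - qone" using e by (auto simp: frames_def)
  define q where "q = - hprod (e$2) (e'$2)"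
  have "qmult (u,0) (hprod (e'$1) (e'$2)) = hprod (e$1) (e'$2)"
    unfolding e1 hprod_rscale_left by (auto simp: qdefs prod_eq_iff algebra_simps uu')
  then have e2: "e'$2 = rscale (e$2) q" using frame_expand[OF e(1), of "e'$2"] h' by (simp add: q_def)
  obtain a b where ab: "qcnj q = (a,b)" by (metis prod.collapse)
  have "qmult (qcnj q) q = qone" using h'(2) unfolding e2 hprod_rscale_left hprod_rscale h by simp
  then have ab1: "a * cnj a + b * cnj b = 1" using ab
    by (cases q) (auto simp: qdefs algebra_simps)
  show ?thesis
  proof (rule exI[of _ a], rule exI[of _ b], intro conjI ab1 allI impI)
    fix v v' :: "H2^2" and c assume v': "v' $ 1 = rscale (v$1) (u,0) + rscale (e$1) (c,0)"
    have 2: "mc_form e' v' $ 2 $ 1 = qmult (qmult (a,b) (mc_form e v $ 2 $ 1)) (u,0)"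
      unfolding mc_form_eq[OF e(1)] mc_form_eq[OF e(2)] v' e2 hprod_rscale_left hprod_add hprod_rscale h ab
      by (simp add: qdefs prod_eq_iff algebra_simps)
    have 1: "mc_form e' v' $ 1 $ 1 = qmult (qcnj (u,0)) (qmult (mc_form e v $ 1 $ 1) (u,0) + (c,0))"
      unfolding mc_form_eq[OF e(1)] mc_form_eq[OF e(2)] v' e1 hprod_rscale_left hprod_add hprod_rscale h
      by (simp add: qdefs prod_eq_iff algebra_simps)
    show "omega e' v' $ 1 = (a * omega e v $ 1 - cnj b * omega e v $ 2) * u"
     "omega e' v' $ 2 = (b * omega e v $ 1 + cnj a * omega e v $ 2) * u"
     "omega e' v' $ 3 = cnj u * cnj u * omega e v $ 3"
      by (simp_all add: omega_def 1 2 qdefs algebra_simps)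
  qed
qed

lemma Psi_inv:
  fixes a b u :: complex
  assumes "a * cnj a + b * cnj b = 1" "u * cnj u = 1"
   and "\<And>j. w' j $ 1 = (a * w j $ 1 - cnj b * w j $ 2) * u"
       "\<And>j. w' j $ 2 = (b * w j $ 1 + cnj a * w j $ 2) * u"
       "\<And>j. w' j $ 3 = cnj u * cnj u * w j $ 3"
  shows "det (\<chi> i j. w' j $ i :: complex^3^3) = det (\<chi> i j. w j $ i)"
proof -
  have "det (\<chi> i j. w' j $ i :: complex^3^3) = (a * cnj a + b * cnj b) * (u * cnj u)^2 * det (\<chi> i j. w j $ i)"
    unfolding det_3 vec_lambda_beta assms(3,4,5) by algebra
  then show ?thesis using assms(1,2) by simp
qed

lemma herm_inv:
  fixes a b u :: complex and w w' :: "'i \<Rightarrow> complex^3"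
  assumes "a * cnj a + b * cnj b = 1" "u * cnj u = 1"
   and "\<And>j. w' j $ 1 = (a * w j $ 1 - cnj b * w j $ 2) * u"
       "\<And>j. w' j $ 2 = (b * w j $ 1 + cnj a * w j $ 2) * u"
       "\<And>j. w' j $ 3 = cnj u * cnj u * w j $ 3"
  shows "(\<Sum>i\<in>UNIV. w' j $ i * cnj (w' k $ i)) = (\<Sum>i\<in>UNIV. w j $ i * cnj (w k $ i))"
proof -
  have "(\<Sum>i\<in>UNIV. w' j $ i * cnj (w' k $ i)) = (a * cnj a + b * cnj b) * (u * cnj u) * (w j $ 1 * cnj (w k $ 1) + w j $ 2 * cnj (w k $ 2)) + (u * cnj u)^2 * (w j $ 3 * cnj (w k $ 3))"
    unfolding sum_3 assms(3,4,5) complex_cnj_mult complex_cnj_add complex_cnj_diff complex_cnj_cnj by algebra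
  then show ?thesis using assms(1,2) by (simp add: sum_3)
qed

lemma frame_rel:
  assumes e: "e \<in> frames" "e' \<in> frames"
    and c: "\<And>i. frame_curve e (\<gamma> i) (v i)" "\<And>i. frame_curve e' (\<gamma>' i) (v' i)"
    and eq: "\<And>i. velocity PsiCP3_atlas (frame_proj \<circ> \<gamma> i) = velocity PsiCP3_atlas (frame_proj \<circ> \<gamma>' i)"
  shows "\<exists>a b u. a * cnj a + b * cnj b = 1 \<and> u * cnj u = 1 \<and> (\<forall>i.
     omega e' (v' i) $ 1 = (a * omega e (v i) $ 1 - cnj b * omega e (v i) $ 2) * u \<and>
     omega e' (v' i) $ 2 = (b * omega e (v i) $ 1 + cnj a * omega e (v i) $ 2) * u \<and>
     omega e' (v' i) $ 3 = cnj u * cnj u * omega e (v i) $ 3)"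
proof -
  have "frame_proj e = frame_proj e'" using velocity_base(1)[OF e(1) c eq] .
  then obtain u where u: "cmod u = 1" "e' $ 1 = rscale (e$1) (u,0)"
    unfolding frame_proj_def using orbit_eqD by metis
  have uu: "u * cnj u = 1" using u by (simp add: complex_norm_square[symmetric])
  have "\<And>i. \<exists>c. v' i $ 1 = rscale (v i$1) (u,0) + rscale (e$1) (c,0)"
    using velocity_eqD[OF e c eq u(2,1)] .
  then show ?thesis using omega_change[OF e u(2,1)] uu by meson
qed

lemma descend_pullback:
  assumes \<eta>: "\<And>e v e' v' a b u. a * cnj a + b * cnj b = 1 \<Longrightarrow> u * cnj u = 1 \<Longrightarrow> (\<And>i.
     omega e' (v' i) $ 1 = (a * omega e (v i) $ 1 - cnj b * omega e (v i) $ 2) * u \<and>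
     omega e' (v' i) $ 2 = (b * omega e (v i) $ 1 + cnj a * omega e (v i) $ 2) * u \<and>
     omega e' (v' i) $ 3 = cnj u * cnj u * omega e (v i) $ 3) \<Longrightarrow> \<eta> e' v' = \<eta> e v"
  and e: "e \<in> frames" and c: "\<And>i. frame_curve e (\<gamma> i) (v i)"
  shows "descend \<eta> (\<lambda>i. velocity PsiCP3_atlas (frame_proj \<circ> \<gamma> i)) = \<eta> e v"
  unfolding descend_def
proof (rule the_equality)
  show "\<exists>e'\<in>frames. \<exists>\<gamma>' v'. (\<forall>i. frame_curve e' (\<gamma>' i) (v' i) \<and>
     velocity PsiCP3_atlas (frame_proj \<circ> \<gamma> i) = velocity PsiCP3_atlas (frame_proj \<circ> \<gamma>' i)) \<and> \<eta> e v = \<eta> e' v'"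
    by (rule bexI[OF _ e], rule exI[of _ \<gamma>], rule exI[of _ v]) (simp add: c)
  fix y assume "\<exists>e'\<in>frames. \<exists>\<gamma>' v'. (\<forall>i. frame_curve e' (\<gamma>' i) (v' i) \<and>
     velocity PsiCP3_atlas (frame_proj \<circ> \<gamma> i) = velocity PsiCP3_atlas (frame_proj \<circ> \<gamma>' i)) \<and> y = \<eta> e' v'"
  then obtain e' \<gamma>' v' where *: "e' \<in> frames" "\<And>i. frame_curve e' (\<gamma>' i) (v' i)"
    "\<And>i. velocity PsiCP3_atlas (frame_proj \<circ> \<gamma> i) = velocity PsiCP3_atlas (frame_proj \<circ> \<gamma>' i)" "y = \<eta> e' v'"
    by blast
  obtain a b u where "a * cnj a + b * cnj b = 1" "u * cnj u = 1" "\<And>i.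
     omega e' (v' i) $ 1 = (a * omega e (v i) $ 1 - cnj b * omega e (v i) $ 2) * u \<and>
     omega e' (v' i) $ 2 = (b * omega e (v i) $ 1 + cnj a * omega e (v i) $ 2) * u \<and>
     omega e' (v' i) $ 3 = cnj u * cnj u * omega e (v i) $ 3"
    using frame_rel[of e e' \<gamma> v \<gamma>' v', OF e *(1) c *(2,3)] by blast
  note ab = this
  have "\<eta> e' v' = \<eta> e v" by (rule \<eta>[of a b u e' v' e v, OF ab])
  then show "y = \<eta> e v" using *(4) by simp
qed

lemma pullback_Psi:
  assumes "e \<in> frames" "\<And>i. frame_curve e (\<gamma> i) (v i)"
  shows "su3_Psi PsiCP3_su3 (\<lambda>i. velocity PsiCP3_atlas (frame_proj \<circ> \<gamma> i)) = frame_Psi e v"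
  unfolding PsiCP3_su3_def su3_structure.simps
proof (rule descend_pullback[OF _ assms])
  fix e v e' v' and a b u :: complex
  assume 1: "a * cnj a + b * cnj b = 1" "u * cnj u = 1" and 2: "(\<And>i :: 3.
     omega e' (v' i) $ 1 = (a * omega e (v i) $ 1 - cnj b * omega e (v i) $ 2) * u \<and>
     omega e' (v' i) $ 2 = (b * omega e (v i) $ 1 + cnj a * omega e (v i) $ 2) * u \<and>
     omega e' (v' i) $ 3 = cnj u * cnj u * omega e (v i) $ 3)"
  show "frame_Psi e' v' = frame_Psi e v"
    unfolding frame_Psi_def
    by (rule Psi_inv[where w = "\<lambda>i. omega e (v i)" and w' = "\<lambda>i. omega e' (v' i)", OF 1]) (use 2 in auto)
qed

lemma pullback_metric:
  assumes "e \<in> frames" "\<And>i. frame_curve e (\<gamma> i) (v i)"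
  shows "su3_metric PsiCP3_su3 (\<lambda>i. velocity PsiCP3_atlas (frame_proj \<circ> \<gamma> i)) = frame_metric e v"
  unfolding PsiCP3_su3_def su3_structure.simps
proof (rule descend_pullback[OF _ assms])
  fix e v e' v' and a b u :: complex
  assume 1: "a * cnj a + b * cnj b = 1" "u * cnj u = 1" and 2: "(\<And>i :: 2.
     omega e' (v' i) $ 1 = (a * omega e (v i) $ 1 - cnj b * omega e (v i) $ 2) * u \<and>
     omega e' (v' i) $ 2 = (b * omega e (v i) $ 1 + cnj a * omega e (v i) $ 2) * u \<and>
     omega e' (v' i) $ 3 = cnj u * cnj u * omega e (v i) $ 3)"
  have "(\<Sum>i\<in>UNIV. omega e' (v' j) $ i * cnj (omega e' (v' k) $ i)) = (\<Sum>i\<in>UNIV. omega e (v j) $ i * cnj (omega e (v k) $ i))" for j k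
    by (rule herm_inv[OF 1]) (use 2 in auto)
  then show "frame_metric e' v' = frame_metric e v"
    by (simp add: frame_metric_def sum_divide_distrib[symmetric] sum.distrib del: Re_sum)
qed

lemma pullback_Omega:
  assumes "e \<in> frames" "\<And>i. frame_curve e (\<gamma> i) (v i)"
  shows "su3_Omega PsiCP3_su3 (\<lambda>i. velocity PsiCP3_atlas (frame_proj \<circ> \<gamma> i)) = frame_Omega e v"
  unfolding PsiCP3_su3_def su3_structure.simps
proof (rule descend_pullback[OF _ assms])
  fix e v e' v' and a b u :: complex
  assume 1: "a * cnj a + b * cnj b = 1" "u * cnj u = 1" and 2: "(\<And>i :: 2.
     omega e' (v' i) $ 1 = (a * omega e (v i) $ 1 - cnj b * omega e (v i) $ 2) * u \<and>
     omega e' (v' i) $ 2 = (b * omega e (v i) $ 1 + cnj a * omega e (v i) $ 2) * u \<and>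
     omega e' (v' i) $ 3 = cnj u * cnj u * omega e (v i) $ 3)"
  have "(\<Sum>i\<in>UNIV. omega e' (v' j) $ i * cnj (omega e' (v' k) $ i)) = (\<Sum>i\<in>UNIV. omega e (v j) $ i * cnj (omega e (v k) $ i))" for j k
    by (rule herm_inv[OF 1]) (use 2 in auto)
  then show "frame_Omega e' v' = frame_Omega e v"
    by (simp add: frame_Omega_def sum_subtractf del: Re_sum)
qed

end

theory Submission
  imports Defs
begin

text \<open>
  A real vector has its quaternionic coordinates \<open>q\<^sub>1, q\<^sub>2\<close> in the commutative field
  \<open>\<real> + j \<real>\<close>. Completing it to the frame with second vector
  \<open>(cnj q\<^sub>2, cnj q\<^sub>1)\<close> makes all three forms \<open>\<omega>\<^sub>i\<close> real along the real locus.
  If \<open>R\<close> is the real matrix of their values on coordinate vectors, then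
  \<open>\<Psi>\<close> takes the value \<open>det R\<close> and the Gram matrix of the metric is
  \<open>R\<^sup>T R\<close>, so \<open>Re \<Psi>\<close> is the volume form up to orientation. In the coordinates
  \<open>(1 : u\<^sub>1 : u\<^sub>2 : u\<^sub>3)\<close> and \<open>(-u\<^sub>1 : 1 : u\<^sub>2 : u\<^sub>3)\<close>, which are
  compatibly oriented, \<open>det R\<close> is positive.
\<close>

section \<open>Closure properties of \<open>Ck_on\<close>\<close>

lemma Ck_on_SucD:
  assumes "open S" "Ck_on (Suc k) S f"
  shows "x \<in> S \<Longrightarrow> (f has_derivative frechet_derivative f (at x)) (at x)"
    and "Ck_on k S (\<lambda>x. frechet_derivative f (at x) v)"
  using assms by (auto simp: differentiable_on_eq_differentiable_at frechet_derivative_works)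

lemma Ck_on_cong:
  assumes "open S" "\<And>x. x \<in> S \<Longrightarrow> f x = g x" "Ck_on k S f"
  shows "Ck_on k S g"
  using assms(2,3)
proof (induction k arbitrary: f g)
  case 0
  then show ?case by (simp cong: continuous_on_cong)
next
  case (Suc k)
  have D: "(g has_derivative frechet_derivative f (at x)) (at x)" if "x \<in> S" for x
    using Ck_on_SucD(1)[OF assms(1) Suc.prems(2) that] assms(1) that Suc.prems(1)
    by (rule has_derivative_transform_within_open)
  have "Ck_on k S (\<lambda>x. frechet_derivative g (at x) v)" for v
    by (rule Suc.IH[OF _ Ck_on_SucD(2)[OF assms(1) Suc.prems(2), of v]])
      (use D frechet_derivative_at in metis)
  moreover have "g differentiable_on S"
    using D unfolding differentiable_on_def differentiable_def by (meson has_derivative_at_withinI)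
  ultimately show ?case by simp
qed

lemma Ck_on_SucI:
  assumes "open S" "\<And>x. x \<in> S \<Longrightarrow> (f has_derivative f' x) (at x)"
    and "\<And>v. Ck_on k S (\<lambda>x. f' x v)"
  shows "Ck_on (Suc k) S f"
proof -
  have "Ck_on k S (\<lambda>x. frechet_derivative f (at x) v)" for v
    by (rule Ck_on_cong[OF assms(1) _ assms(3)[of v]]) (use assms(2) frechet_derivative_at in metis)
  moreover have "f differentiable_on S"
    using assms(2) unfolding differentiable_on_def differentiable_def
    by (meson has_derivative_at_withinI)
  ultimately show ?thesis by simp
qed

lemma Ck_on_pred: "Ck_on (Suc k) S f \<Longrightarrow> Ck_on k S f"
  by (induction k arbitrary: f) (auto intro: differentiable_imp_continuous_on)

lemma Ck_on_const: "open S \<Longrightarrow> Ck_on k S (\<lambda>x. c)"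
  by (induction k arbitrary: c) (auto intro!: Ck_on_SucI derivative_eq_intros)

lemma Ck_on_bounded_linear:
  assumes "open S" "bounded_linear f"
  shows "Ck_on k S f"
proof (cases k)
  case 0
  then show ?thesis using assms by (simp add: linear_continuous_on)
next
  case (Suc m)
  have "Ck_on (Suc m) S f"
    by (rule Ck_on_SucI[where f' = "\<lambda>x. f"])
      (use assms Ck_on_const in \<open>auto intro: bounded_linear_imp_has_derivative\<close>)
  then show ?thesis using Suc by simp
qed

lemma Ck_on_add:
  assumes "open S" "Ck_on k S f" "Ck_on k S g"
  shows "Ck_on k S (\<lambda>x. f x + g x)"
  using assms(2,3)
proof (induction k arbitrary: f g)
  case 0
  then show ?case by (simp add: continuous_on_add)
next
  case (Suc k)
  note D = Ck_on_SucD[OF assms(1)]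
  show ?case
    by (rule Ck_on_SucI[OF assms(1) has_derivative_add[OF D(1)[OF Suc.prems(1)] D(1)[OF Suc.prems(2)]]])
      (use Suc.IH D(2)[OF Suc.prems(1)] D(2)[OF Suc.prems(2)] assms(1) in auto)
qed

lemma Ck_on_compose_bounded_linear:
  assumes "open S" "bounded_linear h" "Ck_on k S f"
  shows "Ck_on k S (\<lambda>x. h (f x))"
  using assms(3)
proof (induction k arbitrary: f)
  case 0
  then show ?case using assms(2) by (simp add: bounded_linear.continuous_on)
next
  case (Suc k)
  note D = Ck_on_SucD[OF assms(1)]
  show ?case
    by (rule Ck_on_SucI[OF assms(1) bounded_linear.has_derivative[OF assms(2) D(1)[OF Suc.prems]]])
      (use Suc.IH D(2)[OF Suc.prems] assms(1) in auto)
qed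

lemma Ck_on_Pair:
  assumes "open S" "Ck_on k S f" "Ck_on k S g"
  shows "Ck_on k S (\<lambda>x. (f x, g x))"
proof -
  have "bounded_linear (\<lambda>y. (y, 0))" "bounded_linear (\<lambda>y. (0, y))"
    by (simp_all add: bounded_linear_Pair bounded_linear_ident bounded_linear_zero)
  from Ck_on_add[OF assms(1) Ck_on_compose_bounded_linear[OF assms(1) this(1) assms(2)]
      Ck_on_compose_bounded_linear[OF assms(1) this(2) assms(3)]]
  show ?thesis by simp
qed

lemma Ck_on_mult:
  fixes f g :: "'a::euclidean_space \<Rightarrow> 'b::real_normed_algebra"
  assumes "open S" "Ck_on k S f" "Ck_on k S g"
  shows "Ck_on k S (\<lambda>x. f x * g x)"
  using assms(2,3)
proof (induction k arbitrary: f g)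
  case 0
  then show ?case by (simp add: continuous_on_mult)
next
  case (Suc k)
  note D = Ck_on_SucD[OF assms(1)]
  show ?case
    by (rule Ck_on_SucI[OF assms(1) has_derivative_mult[OF D(1)[OF Suc.prems(1)] D(1)[OF Suc.prems(2)]]])
      (use Suc.IH D(2)[OF Suc.prems(1)] D(2)[OF Suc.prems(2)] Suc.prems[THEN Ck_on_pred] assms(1)
        in \<open>auto intro!: Ck_on_add\<close>)
qed

lemma Ck_on_inverse:
  fixes f :: "'a::euclidean_space \<Rightarrow> 'b::real_normed_field"
  assumes "open S" "\<And>x. x \<in> S \<Longrightarrow> f x \<noteq> 0" "Ck_on k S f"
  shows "Ck_on k S (\<lambda>x. inverse (f x))"
  using assms(3)
proof (induction k)
  case 0
  then show ?case using assms(2) by (auto intro: continuous_on_inverse)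
next
  case (Suc k)
  note D = Ck_on_SucD[OF assms(1) Suc.prems]
  show ?case
    by (rule Ck_on_SucI[OF assms(1) Deriv.has_derivative_inverse[OF _ D(1)]])
      (use Suc.IH[OF Ck_on_pred[OF Suc.prems]] D(2) assms
        in \<open>auto intro!: Ck_on_mult Ck_on_compose_bounded_linear[OF _ bounded_linear_minus[OF bounded_linear_ident]]\<close>)
qed

section \<open>Homogeneous coordinates\<close>

definition hq :: "H2 \<Rightarrow> real" where
  "hq v = (cmod (fst (fst v)))\<^sup>2 + (cmod (snd (fst v)))\<^sup>2
        - (cmod (fst (snd v)))\<^sup>2 - (cmod (snd (snd v)))\<^sup>2"

definition hproj :: "H2 \<Rightarrow> H2 set" where
  "hproj v = circle_orbit ((1 / sqrt (hq v)) *\<^sub>R v)"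

definition hcoord :: "bool \<Rightarrow> H2 \<Rightarrow> complex" where
  "hcoord b v = (if b then fst (fst v) else snd (fst v))"

definition affine_coord :: "bool \<Rightarrow> H2 \<Rightarrow> complex \<times> complex \<times> complex" where
  "affine_coord b = (if b then affine1 else affine2)"

definition affine_chart :: "bool \<Rightarrow> (H2 set, complex \<times> complex \<times> complex) chart" where
  "affine_chart b = (circle_orbit ` {x \<in> PsiS7. hcoord b x \<noteq> 0}, \<lambda>Q. the_elem (affine_coord b ` Q))"

definition hom_pt :: "bool \<Rightarrow> complex \<times> complex \<times> complex \<Rightarrow> H2" where
  "hom_pt b w = (if b then (1, fst w) else (fst w, 1), snd w)"

lemma PsiCP3_atlas_eq: "PsiCP3_atlas = range affine_chart"
  by (auto simp: PsiCP3_atlas_def affine_chart_def hcoord_def affine_coord_def UNIV_bool)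

lemma PsiS7_iff: "x \<in> PsiS7 \<longleftrightarrow> hq x = 1"
proof -
  have "qmult (qcnj (fst x)) (fst x) - qmult (qcnj (snd x)) (snd x) = (complex_of_real (hq x), 0)"
    by (simp add: hq_def qdefs prod_eq_iff complex_norm_square[symmetric] mult.commute)
  then show ?thesis by (auto simp: PsiS7_def qone_def case_prod_beta)
qed

lemma rscale_complex:
  "rscale v (c, 0) = ((c * fst (fst v), c * snd (fst v)), (c * fst (snd v), c * snd (snd v)))"
  by (simp add: qdefs mult.commute)

lemma hq_rscale: "hq (rscale v (c, 0)) = (cmod c)\<^sup>2 * hq v"
  by (simp add: hq_def rscale_complex norm_mult power_mult_distrib algebra_simps)

lemma scaleR_eq_rscale: "a *\<^sub>R v = rscale v (of_real a, 0)" for v :: H2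
  by (simp add: rscale_complex prod_eq_iff scaleR_conv_of_real)

lemma rscale_rscale: "rscale (rscale v (c, 0)) (d, 0) = rscale v (d * c, 0)"
  by (simp add: rscale_complex)

lemma circle_orbit_rscale:
  assumes "cmod c = 1"
  shows "circle_orbit (rscale x (c, 0)) = circle_orbit x"
proof -
  have "\<exists>u'. rscale x (u, 0) = rscale x (u' * c, 0) \<and> cmod u' = 1" if "cmod u = 1" for u
    by (rule exI[of _ "u / c"]) (use that assms in \<open>auto simp: norm_divide\<close>)
  then show ?thesis
    unfolding circle_orbit_def rscale_rscale using assms by (fastforce simp: norm_mult)
qed

lemma hproj_rscale:
  assumes "c \<noteq> 0"
  shows "hproj (rscale v (c, 0)) = hproj v"
proof -
  let ?s = "1 / sqrt (hq v)"
  have "(1 / sqrt (hq (rscale v (c, 0)))) *\<^sub>R rscale v (c, 0)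
      = rscale (?s *\<^sub>R v) (c / of_real (cmod c), 0)"
    by (simp add: hq_rscale scaleR_eq_rscale rscale_rscale real_sqrt_mult)
  then show ?thesis
    using assms by (simp add: hproj_def circle_orbit_rscale norm_divide)
qed

lemma hproj_unit: "hq x = 1 \<Longrightarrow> hproj x = circle_orbit x"
  by (simp add: hproj_def)

lemma hq_normalize: "hq v > 0 \<Longrightarrow> hq ((1 / sqrt (hq v)) *\<^sub>R v) = 1"
  by (simp add: scaleR_eq_rscale hq_rscale norm_divide power_divide)

lemma hproj_in_PsiCP3: "hq v > 0 \<Longrightarrow> hproj v \<in> PsiCP3"
  by (auto simp: hproj_def PsiCP3_def PsiS7_iff hq_normalize)

lemma PsiCP3_cases:
  assumes "Q \<in> PsiCP3"
  obtains v where "hq v = 1" "Q = hproj v"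
  using assms by (auto simp: PsiCP3_def PsiS7_iff hproj_unit)

lemma hcoord_nonzero:
  assumes "hq v > 0"
  shows "hcoord True v \<noteq> 0 \<or> hcoord False v \<noteq> 0"
proof (rule ccontr)
  assume "\<not> ?thesis"
  then show False
    using assms zero_le_power2[of "cmod (fst (snd v))"] zero_le_power2[of "cmod (snd (snd v))"]
    by (simp add: hq_def hcoord_def)
qed

lemma hcoord_rscale: "hcoord b (rscale v (c, 0)) = c * hcoord b v"
  by (simp add: hcoord_def rscale_complex)

lemma affine_coord_rscale: "c \<noteq> 0 \<Longrightarrow> affine_coord b (rscale v (c, 0)) = affine_coord b v"
  by (cases v; cases b) (auto simp: affine_coord_def affine1_def affine2_def rscale_complex)

lemma the_elem_affine_coord:
  assumes "x \<in> PsiS7" "hcoord b x \<noteq> 0"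
  shows "the_elem (affine_coord b ` circle_orbit x) = affine_coord b x"
  using assms elem1 elem2 by (cases b) (auto simp: affine_coord_def hcoord_def)

lemma circle_orbit_hcoord:
  assumes "circle_orbit x = circle_orbit y"
  shows "hcoord b x = 0 \<longleftrightarrow> hcoord b y = 0"
  using assms by (elim orbit_eqD) (auto simp: hcoord_rscale)

lemma hproj_in_chart:
  assumes "hq v > 0"
  shows "hproj v \<in> fst (affine_chart b) \<longleftrightarrow> hcoord b v \<noteq> 0"
proof -
  let ?x = "(1 / sqrt (hq v)) *\<^sub>R v"
  have x: "?x \<in> PsiS7" using assms by (simp add: PsiS7_iff hq_normalize)
  have "hproj v \<in> fst (affine_chart b) \<longleftrightarrow> hcoord b ?x \<noteq> 0"
    unfolding affine_chart_def hproj_def fst_conv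
    using x circle_orbit_hcoord[of ?x _ b] by blast
  then show ?thesis using assms by (simp add: scaleR_eq_rscale hcoord_rscale)
qed

lemma chart_hproj:
  assumes "hq v > 0" "hcoord b v \<noteq> 0"
  shows "snd (affine_chart b) (hproj v) = affine_coord b v"
proof -
  let ?x = "(1 / sqrt (hq v)) *\<^sub>R v"
  have "?x \<in> PsiS7" using assms by (simp add: PsiS7_iff hq_normalize)
  moreover have "hcoord b ?x \<noteq> 0" using assms by (simp add: scaleR_eq_rscale hcoord_rscale)
  ultimately have "the_elem (affine_coord b ` hproj v) = affine_coord b ?x"
    unfolding hproj_def by (rule the_elem_affine_coord)
  then show ?thesis using assms by (simp add: affine_chart_def scaleR_eq_rscale affine_coord_rscale)
qed

lemma hom_pt_affine:
  "hcoord b v \<noteq> 0 \<Longrightarrow> hom_pt b (affine_coord b v) = rscale v (inverse (hcoord b v), 0)"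
  by (cases v; cases b)
    (auto simp: hom_pt_def affine_coord_def affine1_def affine2_def hcoord_def rscale_complex field_simps)

lemma affine_coord_hom_pt [simp]: "affine_coord b (hom_pt b w) = w"
  by (cases w) (auto simp: hom_pt_def affine_coord_def affine1_def affine2_def)

lemma hcoord_hom_pt [simp]: "hcoord b (hom_pt b w) = 1"
  by (simp add: hom_pt_def hcoord_def)

lemma hproj_hom_pt_affine: "hcoord b v \<noteq> 0 \<Longrightarrow> hproj (hom_pt b (affine_coord b v)) = hproj v"
  by (simp add: hom_pt_affine hproj_rscale)

lemma hq_hom_pt_affine: "hcoord b v \<noteq> 0 \<Longrightarrow> hq v > 0 \<Longrightarrow> hq (hom_pt b (affine_coord b v)) > 0"
  by (simp add: hom_pt_affine hq_rscale)

section \<open>The manifold topology is the quotient topology\<close>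

lemma continuous_on_hq [continuous_intros]: "continuous_on S hq"
  unfolding hq_def by (intro continuous_intros)

lemma continuous_on_hom_pt: "continuous_on S (hom_pt b)"
  unfolding hom_pt_def by (cases b) (auto intro!: continuous_intros)

lemma continuous_on_hcoord [continuous_intros]: "continuous_on S (hcoord b)"
  unfolding hcoord_def by (cases b) (auto intro!: continuous_intros)

lemma continuous_on_affine_coord: "(\<And>v. v \<in> S \<Longrightarrow> hcoord b v \<noteq> 0) \<Longrightarrow> continuous_on S (affine_coord b)"
  by (cases b)
    (auto simp: affine_coord_def affine1_def affine2_def hcoord_def case_prod_beta intro!: continuous_intros)

lemma open_hq_hcoord: "open {v. hq v > 0 \<and> hcoord b v \<noteq> 0}"
  by (intro open_Collect_conj open_Collect_less open_Collect_neq continuous_intros)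

lemma open_affine_vimage:
  assumes "open T"
  shows "open {v. hq v > 0 \<and> hcoord b v \<noteq> 0 \<and> affine_coord b v \<in> T}"
proof -
  have "open ({v. hq v > 0 \<and> hcoord b v \<noteq> 0} \<inter> affine_coord b -` T)"
    by (rule continuous_open_preimage[OF continuous_on_affine_coord open_hq_hcoord assms]) simp
  then show ?thesis by (simp add: vimage_def Collect_conj_eq[symmetric] conj_assoc)
qed

lemma chart_image:
  assumes "Q \<subseteq> PsiCP3"
  shows "snd (affine_chart b) ` (Q \<inter> fst (affine_chart b)) = {w. hq (hom_pt b w) > 0 \<and> hproj (hom_pt b w) \<in> Q}"
proof (intro equalityI subsetI)
  fix w assume "w \<in> snd (affine_chart b) ` (Q \<inter> fst (affine_chart b))"
  then obtain x where x: "x \<in> Q" "x \<in> fst (affine_chart b)" "w = snd (affine_chart b) x" by auto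
  obtain v where v: "hq v = 1" "x = hproj v" using x(1) assms PsiCP3_cases by blast
  then have "hcoord b v \<noteq> 0" using x(2) hproj_in_chart by simp
  then show "w \<in> {w. hq (hom_pt b w) > 0 \<and> hproj (hom_pt b w) \<in> Q}"
    using x v by (simp add: chart_hproj hproj_hom_pt_affine hq_hom_pt_affine)
next
  fix w assume w: "w \<in> {w. hq (hom_pt b w) > 0 \<and> hproj (hom_pt b w) \<in> Q}"
  then have "w = snd (affine_chart b) (hproj (hom_pt b w))" by (simp add: chart_hproj)
  moreover have "hproj (hom_pt b w) \<in> Q \<inter> fst (affine_chart b)" using w by (simp add: hproj_in_chart)
  ultimately show "w \<in> snd (affine_chart b) ` (Q \<inter> fst (affine_chart b))" by blast
qed

lemma open_charts_iff:
  assumes "Q \<subseteq> PsiCP3"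
  shows "(\<forall>(U, \<phi>)\<in>PsiCP3_atlas. open (\<phi> ` (Q \<inter> U))) \<longleftrightarrow> open {v. hq v > 0 \<and> hproj v \<in> Q}"
proof -
  let ?T = "\<lambda>b. {w. hq (hom_pt b w) > 0 \<and> hproj (hom_pt b w) \<in> Q}"
  let ?C = "{v. hq v > 0 \<and> hproj v \<in> Q}"
  have "(\<forall>(U, \<phi>)\<in>PsiCP3_atlas. open (\<phi> ` (Q \<inter> U))) \<longleftrightarrow> (\<forall>b. open (?T b))"
    by (simp add: PsiCP3_atlas_eq case_prod_beta chart_image[OF assms])
  also have "\<dots> \<longleftrightarrow> open ?C"
  proof
    assume T: "\<forall>b. open (?T b)"
    have "?C = (\<Union>b. {v. hq v > 0 \<and> hcoord b v \<noteq> 0 \<and> affine_coord b v \<in> ?T b})"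
    proof (intro equalityI subsetI)
      fix v assume v: "v \<in> ?C"
      then obtain b where "hcoord b v \<noteq> 0" using hcoord_nonzero by blast
      then show "v \<in> (\<Union>b. {v. hq v > 0 \<and> hcoord b v \<noteq> 0 \<and> affine_coord b v \<in> ?T b})"
        using v by (intro UN_I[of b]) (simp_all add: hproj_hom_pt_affine hq_hom_pt_affine)
    qed (auto simp: hproj_hom_pt_affine)
    then show "open ?C"
      by (rule ssubst) (intro open_UN ballI open_affine_vimage T[rule_format])
  next
    assume C: "open ?C"
    show "\<forall>b. open (?T b)"
    proof
      fix b
      have "?T b = hom_pt b -` ?C" by (simp add: vimage_def)
      then show "open (?T b)" using open_vimage[OF C continuous_on_hom_pt] by simp
    qed
  qed
  finally show ?thesis .
qed

lemma mspace_of_PsiCP3_atlas: "mspace_of PsiCP3_atlas = PsiCP3"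
  using S7_ne by (fastforce simp: mspace_of_def PsiCP3_atlas_def PsiCP3_def)

lemma openin_PsiCP3_iff:
  "openin (mtopology_of PsiCP3_atlas) Q \<longleftrightarrow> Q \<subseteq> PsiCP3 \<and> open {v. hq v > 0 \<and> hproj v \<in> Q}"
proof -
  let ?P = "\<lambda>Q. Q \<subseteq> PsiCP3 \<and> open {v. hq v > 0 \<and> hproj v \<in> Q}"
  have "istopology ?P"
    unfolding istopology_def
  proof (intro conjI allI impI; (elim conjE)?)
    fix S T assume "S \<subseteq> PsiCP3" "T \<subseteq> PsiCP3"
      and o: "open {v. hq v > 0 \<and> hproj v \<in> S}" "open {v. hq v > 0 \<and> hproj v \<in> T}"
    then show "S \<inter> T \<subseteq> PsiCP3" by blast
    show "open {v. hq v > 0 \<and> hproj v \<in> S \<inter> T}"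
      using open_Int[OF o] by (rule back_subst[where P = "open"]) auto
  next
    fix K assume K: "\<forall>S\<in>K. S \<subseteq> PsiCP3 \<and> open {v. hq v > 0 \<and> hproj v \<in> S}"
    then show "\<Union> K \<subseteq> PsiCP3" by blast
    have "open (\<Union>S\<in>K. {v. hq v > 0 \<and> hproj v \<in> S})" by (intro open_UN) (use K in simp)
    moreover have "{v. hq v > 0 \<and> hproj v \<in> \<Union> K} = (\<Union>S\<in>K. {v. hq v > 0 \<and> hproj v \<in> S})" by blast
    ultimately show "open {v. hq v > 0 \<and> hproj v \<in> \<Union> K}" by simp
  qed
  moreover have "mtopology_of PsiCP3_atlas = topology ?P"
    unfolding mtopology_of_def mspace_of_PsiCP3_atlas
    by (rule arg_cong[where f = topology]) (simp add: fun_eq_iff open_charts_iff cong: conj_cong)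
  ultimately show ?thesis by (simp add: topology_inverse')
qed

lemma topspace_PsiCP3: "topspace (mtopology_of PsiCP3_atlas) = PsiCP3"
proof -
  have "{v. hq v > 0 \<and> hproj v \<in> PsiCP3} = {v. hq v > 0}" using hproj_in_PsiCP3 by blast
  then have "openin (mtopology_of PsiCP3_atlas) PsiCP3"
    by (simp add: openin_PsiCP3_iff open_Collect_less continuous_intros)
  then show ?thesis
    using openin_PsiCP3_iff openin_subset openin_topspace by blast
qed

lemma openin_chart_vimage:
  assumes "open T"
  shows "openin (mtopology_of PsiCP3_atlas) {Q \<in> fst (affine_chart b). snd (affine_chart b) Q \<in> T}"
proof -
  have "{v. hq v > 0 \<and> hproj v \<in> {Q \<in> fst (affine_chart b). snd (affine_chart b) Q \<in> T}}
      = {v. hq v > 0 \<and> hcoord b v \<noteq> 0 \<and> affine_coord b v \<in> T}"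
    using hproj_in_chart chart_hproj by auto
  moreover have "fst (affine_chart b) \<subseteq> PsiCP3" by (auto simp: affine_chart_def PsiCP3_def)
  ultimately show ?thesis using open_affine_vimage[OF assms] by (auto simp: openin_PsiCP3_iff)
qed

lemma continuous_map_chart:
  "continuous_map (subtopology (mtopology_of PsiCP3_atlas) (fst (affine_chart b))) euclidean (snd (affine_chart b))"
  unfolding continuous_map_def
proof (intro conjI allI impI)
  fix T :: "(complex \<times> complex \<times> complex) set" assume "openin euclidean T"
  then have T: "openin (mtopology_of PsiCP3_atlas) {Q \<in> fst (affine_chart b). snd (affine_chart b) Q \<in> T}"
    using openin_chart_vimage by simp
  have "fst (affine_chart b) \<subseteq> PsiCP3" by (auto simp: affine_chart_def PsiCP3_def)
  then have U: "topspace (subtopology (mtopology_of PsiCP3_atlas) (fst (affine_chart b))) = fst (affine_chart b)"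
    by (auto simp: topspace_PsiCP3)
  show "openin (subtopology (mtopology_of PsiCP3_atlas) (fst (affine_chart b)))
     {x \<in> topspace (subtopology (mtopology_of PsiCP3_atlas) (fst (affine_chart b))).
       snd (affine_chart b) x \<in> T}"
    unfolding U openin_subtopology by (intro exI conjI, rule T) auto
qed simp

section \<open>Affine parametrizations of the real locus\<close>

definition rsign :: "bool \<Rightarrow> real" where
  "rsign b = (if b then 1 else - 1)"

definition rcoord :: "bool \<Rightarrow> real ^ 3 \<Rightarrow> complex \<times> complex \<times> complex" where
  "rcoord b u = (of_real (rsign b * u $ 1), of_real (u $ 2), of_real (u $ 3))"

definition rinv :: "bool \<Rightarrow> complex \<times> complex \<times> complex \<Rightarrow> real ^ 3" where
  "rinv b w = vector [rsign b * Re (fst w), Re (fst (snd w)), Re (snd (snd w))]"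

definition rvec :: "bool \<Rightarrow> real ^ 3 \<Rightarrow> H2" where
  "rvec b u = hom_pt b (rcoord b u)"

definition rdir :: "bool \<Rightarrow> real ^ 3 \<Rightarrow> H2" where
  "rdir b u = (if b then (0, fst (rcoord b u)) else (fst (rcoord b u), 0), snd (rcoord b u))"

definition rdom :: "(real ^ 3) set" where
  "rdom = {u. 0 < 1 + (u $ 1)\<^sup>2 - (u $ 2)\<^sup>2 - (u $ 3)\<^sup>2}"

definition rparam :: "bool \<Rightarrow> real ^ 3 \<Rightarrow> H2 set" where
  "rparam b u = hproj (rvec b u)"

lemma rsign_square [simp]: "rsign b * (rsign b * x) = x"
  by (simp add: rsign_def)

lemma rinv_rcoord [simp]: "rinv b (rcoord b u) = u"
  by (simp add: rinv_def rcoord_def vec_eq_iff forall_3)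

lemma hq_rvec: "hq (rvec b u) = 1 + (u $ 1)\<^sup>2 - (u $ 2)\<^sup>2 - (u $ 3)\<^sup>2"
  by (simp add: hq_def rvec_def hom_pt_def rcoord_def rsign_def norm_mult)

lemma rdom_iff: "u \<in> rdom \<longleftrightarrow> hq (rvec b u) > 0"
  by (simp add: rdom_def hq_rvec)

lemma open_rdom: "open rdom"
  unfolding rdom_def by (intro open_Collect_less continuous_intros)

lemma affine_coord_rvec [simp]: "affine_coord b (rvec b u) = rcoord b u"
  by (simp add: rvec_def)

lemma hcoord_rvec [simp]: "hcoord b (rvec b u) = 1"
  by (simp add: rvec_def)

lemma bounded_linear_rdir: "bounded_linear (rdir b)"
  by (cases b) (auto simp: linear_conv_bounded_linear[symmetric] rdir_def rcoord_def rsign_def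
      scaleR_conv_of_real[symmetric] algebra_simps intro!: linearI)

lemma rvec_add: "rvec b (u + v) = rvec b u + rdir b v"
  by (simp add: rvec_def rdir_def hom_pt_def rcoord_def algebra_simps)

lemma rvec_eq: "rvec b u = rvec b 0 + rdir b u"
  using rvec_add[of b 0 u] by simp

lemma has_derivative_rvec: "(rvec b has_derivative rdir b) (at u)"
proof -
  have "((\<lambda>u. rvec b 0 + rdir b u) has_derivative rdir b) (at u)"
    using has_derivative_add[OF has_derivative_const bounded_linear_imp_has_derivative[OF bounded_linear_rdir]]
    by simp
  then show ?thesis by (simp add: rvec_eq[symmetric])
qed

lemma Ck_on_rvec: "open S \<Longrightarrow> Ck_on k S (rvec b)"
  by (subst rvec_eq[abs_def])
    (intro Ck_on_add Ck_on_const Ck_on_bounded_linear bounded_linear_rdir)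

lemma continuous_on_rvec: "continuous_on S (rvec b)"
  using Ck_on_rvec[OF open_UNIV, of 0 b] continuous_on_subset by auto

lemma affine_coord_eq:
  "affine_coord b = (\<lambda>v. (hcoord (\<not> b) v / hcoord b v, fst (snd v) / hcoord b v, snd (snd v) / hcoord b v))"
  by (auto simp: affine_coord_def affine1_def affine2_def hcoord_def fun_eq_iff)

lemma bounded_linear_hcoord: "bounded_linear (hcoord b)"
  unfolding hcoord_def by (cases b) (auto intro!: bounded_linear_intros)

lemma bounded_linear_fst_snd: "bounded_linear (\<lambda>v. fst (snd v))"
  by (rule bounded_linear_compose[OF bounded_linear_fst bounded_linear_snd])

lemma bounded_linear_snd_snd: "bounded_linear (\<lambda>v. snd (snd v))"
  by (rule bounded_linear_compose[OF bounded_linear_snd bounded_linear_snd])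

lemma Ck_on_affine_coord:
  assumes "open S" "\<And>u. u \<in> S \<Longrightarrow> hcoord b (f u) \<noteq> 0" "Ck_on k S f"
  shows "Ck_on k S (\<lambda>u. affine_coord b (f u))"
proof -
  have h: "Ck_on k S (\<lambda>u. hcoord b (f u))" for b
    by (rule Ck_on_compose_bounded_linear[OF assms(1) bounded_linear_hcoord assms(3)])
  have q: "Ck_on k S (\<lambda>u. g (f u) / hcoord b (f u))" if "bounded_linear g" for g
    unfolding divide_inverse
    by (intro Ck_on_mult Ck_on_inverse Ck_on_compose_bounded_linear[OF _ that] assms h)
  then show ?thesis
    unfolding affine_coord_eq using assms(1)
    by (intro Ck_on_Pair q bounded_linear_hcoord bounded_linear_fst_snd bounded_linear_snd_snd)
qed

lemma inj_affine_coord_rvec_derivative: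
  assumes "hcoord c (rvec b u) \<noteq> 0"
    and D: "((\<lambda>u. affine_coord c (rvec b u)) has_derivative D) (at u)"
  shows "inj D"
proof -
  let ?z = "rvec b u"
  have q: "((\<lambda>u. g (rvec b u) / hcoord c (rvec b u)) has_derivative
      (\<lambda>v. (g (rdir b v) * hcoord c ?z - g ?z * hcoord c (rdir b v)) / (hcoord c ?z * hcoord c ?z))) (at u)"
    if "bounded_linear g" for g
  proof -
    have "((\<lambda>u. g (rvec b u)) has_derivative (\<lambda>v. g (rdir b v))) (at u)"
      by (rule bounded_linear.has_derivative[OF that has_derivative_rvec])
    moreover have "((\<lambda>u. hcoord c (rvec b u)) has_derivative (\<lambda>v. hcoord c (rdir b v))) (at u)"
      by (rule bounded_linear.has_derivative[OF bounded_linear_hcoord has_derivative_rvec])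
    ultimately show ?thesis using assms(1) by (rule has_derivative_divide')
  qed
  let ?q = "\<lambda>g v. (g (rdir b v) * hcoord c ?z - g ?z * hcoord c (rdir b v)) / (hcoord c ?z * hcoord c ?z)"
  have "((\<lambda>u. affine_coord c (rvec b u)) has_derivative
     (\<lambda>v. (?q (hcoord (\<not> c)) v, ?q (\<lambda>v. fst (snd v)) v, ?q (\<lambda>v. snd (snd v)) v))) (at u)"
    unfolding affine_coord_eq
    by (intro has_derivative_Pair q bounded_linear_hcoord bounded_linear_fst_snd bounded_linear_snd_snd)
  then have D_eq: "D = (\<lambda>v. (?q (hcoord (\<not> c)) v, ?q (\<lambda>v. fst (snd v)) v, ?q (\<lambda>v. snd (snd v)) v))"
    using D has_derivative_unique by blast
  have "v = 0" if "D v = 0" for v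
  proof -
    have e: "hcoord (\<not> c) (rdir b v) * hcoord c ?z = hcoord (\<not> c) ?z * hcoord c (rdir b v)"
      "fst (snd (rdir b v)) * hcoord c ?z = fst (snd ?z) * hcoord c (rdir b v)"
      "snd (snd (rdir b v)) * hcoord c ?z = snd (snd ?z) * hcoord c (rdir b v)"
      using that assms(1) by (auto simp: D_eq zero_prod_def)
    have "hcoord b (rdir b v) = 0" by (simp add: rdir_def hcoord_def)
    then have "hcoord c (rdir b v) = 0"
      using e(1) by (cases "b = c") (auto simp: rdir_def)
    then have "hcoord (\<not> c) (rdir b v) = 0" "snd (rdir b v) = 0" "hcoord c (rdir b v) = 0"
      using e assms(1) by (auto simp: prod_eq_iff)
    then show "v = 0"
      by (cases b; cases c) (auto simp: rdir_def rcoord_def hcoord_def rsign_def vec_eq_iff forall_3 prod_eq_iff)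
  qed
  then show ?thesis
    using linear_injective_0[of D] has_derivative_linear[OF D] by blast
qed

lemma PsiRP3_image: "PsiRP3_incl ` PsiRP3 = circle_orbit ` PsiS3"
proof -
  have "- x = rscale x (- 1, 0)" for x by (simp add: rscale_complex prod_eq_iff)
  then have "PsiRP3_incl {x, - x} = circle_orbit x" for x
    using circle_orbit_rscale[of "- 1" x] by (simp add: PsiRP3_incl_def)
  then show ?thesis by (simp add: PsiRP3_def image_image)
qed

lemma PsiS3_iff:
  "x \<in> PsiS3 \<longleftrightarrow> hq x = 1 \<and> fst (fst x) \<in> \<real> \<and> snd (fst x) \<in> \<real> \<and> fst (snd x) \<in> \<real> \<and> snd (snd x) \<in> \<real>"
proof
  assume "hq x = 1 \<and> fst (fst x) \<in> \<real> \<and> snd (fst x) \<in> \<real> \<and> fst (snd x) \<in> \<real> \<and> snd (snd x) \<in> \<real>"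
  moreover obtain z1 z2 z3 z4 where "x = ((z1, z2), (z3, z4))" by (metis prod.collapse)
  ultimately show "x \<in> PsiS3"
    by (auto simp: PsiS3_def hq_def elim!: Reals_cases)
qed (auto simp: PsiS3_def hq_def)

lemma normalized_rvec_in_PsiS3:
  assumes "u \<in> rdom"
  shows "(1 / sqrt (hq (rvec b u))) *\<^sub>R rvec b u \<in> PsiS3"
  using assms hq_normalize[of "rvec b u"]
  by (auto simp: PsiS3_iff rdom_iff[of _ b] rvec_def hom_pt_def rcoord_def scaleR_conv_of_real)

lemma rvec_rinv_affine_coord:
  assumes "x \<in> PsiS3" "hcoord b x \<noteq> 0"
  shows "rvec b (rinv b (affine_coord b x)) = hom_pt b (affine_coord b x)"
proof -
  have "fst (affine_coord b x) \<in> \<real>" "fst (snd (affine_coord b x)) \<in> \<real>" "snd (snd (affine_coord b x)) \<in> \<real>"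
    using assms by (auto simp: affine_coord_eq PsiS3_iff hcoord_def)
  then have "rcoord b (rinv b (affine_coord b x)) = affine_coord b x"
    by (simp add: rcoord_def rinv_def prod_eq_iff)
  then show ?thesis by (simp add: rvec_def)
qed

lemma rparam_in_chart: "u \<in> rdom \<Longrightarrow> rparam b u \<in> fst (affine_chart c) \<longleftrightarrow> hcoord c (rvec b u) \<noteq> 0"
  by (simp add: rparam_def hproj_in_chart rdom_iff[of _ b])

lemma chart_rparam:
  "u \<in> rdom \<Longrightarrow> hcoord c (rvec b u) \<noteq> 0 \<Longrightarrow> snd (affine_chart c) (rparam b u) = affine_coord c (rvec b u)"
  by (simp add: rparam_def chart_hproj rdom_iff[of _ b])

lemma rinv_chart_rparam: "u \<in> rdom \<Longrightarrow> rinv b (snd (affine_chart b) (rparam b u)) = u"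
  by (simp add: chart_rparam)

lemma rparam_image: "rparam b ` rdom = circle_orbit ` PsiS3 \<inter> fst (affine_chart b)"
proof (intro equalityI subsetI)
  fix Q assume "Q \<in> rparam b ` rdom"
  then obtain u where u: "u \<in> rdom" "Q = rparam b u" by auto
  then show "Q \<in> circle_orbit ` PsiS3 \<inter> fst (affine_chart b)"
    using normalized_rvec_in_PsiS3[OF u(1), of b] rparam_in_chart[OF u(1), of b b]
    by (auto simp: rparam_def hproj_def)
next
  fix Q assume Q: "Q \<in> circle_orbit ` PsiS3 \<inter> fst (affine_chart b)"
  then obtain x where x: "x \<in> PsiS3" "Q = circle_orbit x" by auto
  then have hx: "hq x = 1" by (simp add: PsiS3_iff)
  with x Q have c: "hcoord b x \<noteq> 0" using hproj_in_chart[of x b] by (simp add: hproj_unit)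
  let ?u = "rinv b (affine_coord b x)"
  have "?u \<in> rdom"
    using hq_hom_pt_affine[OF c] hx by (simp add: rdom_iff[of _ b] rvec_rinv_affine_coord[OF x(1) c])
  moreover have "Q = rparam b ?u"
    using hx by (simp add: rparam_def rvec_rinv_affine_coord[OF x(1) c] hproj_hom_pt_affine[OF c] hproj_unit x)
  ultimately show "Q \<in> rparam b ` rdom" by blast
qed

lemma continuous_map_rparam:
  "continuous_map (top_of_set rdom) (mtopology_of PsiCP3_atlas) (rparam b)"
  unfolding continuous_map_def
proof (intro conjI allI impI)
  show "rparam b \<in> topspace (top_of_set rdom) \<rightarrow> topspace (mtopology_of PsiCP3_atlas)"
    by (auto simp: rparam_def topspace_PsiCP3 rdom_iff[of _ b] intro!: hproj_in_PsiCP3)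
  fix T assume "openin (mtopology_of PsiCP3_atlas) T"
  then have "open (rvec b -` {v. hq v > 0 \<and> hproj v \<in> T})"
    by (intro open_vimage continuous_on_rvec) (simp add: openin_PsiCP3_iff)
  moreover have "{u \<in> topspace (top_of_set rdom). rparam b u \<in> T} = rdom \<inter> rvec b -` {v. hq v > 0 \<and> hproj v \<in> T}"
    by (auto simp: rparam_def rdom_iff[of _ b])
  ultimately show "openin (top_of_set rdom) {u \<in> topspace (top_of_set rdom). rparam b u \<in> T}"
    by (simp add: openin_open_Int)
qed

lemma continuous_on_rinv: "continuous_on S (rinv b)"
proof -
  have "bounded_linear (rinv b)"
    unfolding linear_conv_bounded_linear[symmetric]
    by (rule linearI) (auto simp: rinv_def vec_eq_iff forall_3 algebra_simps)
  then show ?thesis by (rule linear_continuous_on)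
qed

lemma local_param_rparam: "local_param PsiCP3_atlas (circle_orbit ` PsiS3) (rdom, rparam b)"
proof -
  let ?M = "mtopology_of PsiCP3_atlas"
  have sub: "circle_orbit ` PsiS3 \<subseteq> PsiCP3"
    by (auto simp: PsiCP3_def PsiS7_iff PsiS3_iff)
  have "openin ?M (fst (affine_chart b))"
    using openin_chart_vimage[OF open_UNIV, of b] by simp
  then have 1: "openin (subtopology ?M (circle_orbit ` PsiS3)) (rparam b ` rdom)"
    unfolding rparam_image openin_subtopology by blast
  have "continuous_map (subtopology ?M (rparam b ` rdom)) euclidean (snd (affine_chart b))"
    using continuous_map_from_subtopology_mono[OF continuous_map_chart, of "rparam b ` rdom" b]
    by (simp add: rparam_image)
  then have "continuous_map (subtopology ?M (rparam b ` rdom)) euclidean (rinv b \<circ> snd (affine_chart b))"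
    by (rule continuous_map_compose) (simp add: continuous_on_rinv)
  then have "homeomorphic_maps (top_of_set rdom) (subtopology ?M (rparam b ` rdom)) (rparam b)
      (rinv b \<circ> snd (affine_chart b))"
    unfolding homeomorphic_maps_def
    using sub continuous_map_rparam
    by (auto simp: continuous_map_in_subtopology topspace_PsiCP3 rinv_chart_rparam)
  then have 2: "homeomorphic_map (top_of_set rdom) (subtopology ?M (rparam b ` rdom)) (rparam b)"
    using homeomorphic_map_maps by blast
  have 3: "smooth_on {u \<in> rdom. rparam b u \<in> fst (affine_chart c)} (snd (affine_chart c) \<circ> rparam b)
    \<and> (\<forall>u\<in>rdom. rparam b u \<in> fst (affine_chart c) \<longrightarrow>
         inj (frechet_derivative (snd (affine_chart c) \<circ> rparam b) (at u)))" for c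
  proof -
    let ?S = "{u \<in> rdom. rparam b u \<in> fst (affine_chart c)}"
    have S: "?S = rdom \<inter> {u. hcoord c (rvec b u) \<noteq> 0}" using rparam_in_chart by blast
    have "continuous_on UNIV (\<lambda>u. hcoord c (rvec b u))"
      by (rule continuous_on_compose2[OF continuous_on_hcoord continuous_on_rvec]) auto
    then have o: "open ?S"
      unfolding S by (intro open_Int open_rdom open_Collect_neq) auto
    have eq: "(snd (affine_chart c) \<circ> rparam b) u = affine_coord c (rvec b u)" if "u \<in> ?S" for u
      using that chart_rparam by (auto simp: S)
    have C: "Ck_on k ?S (\<lambda>u. affine_coord c (rvec b u))" for k
      by (rule Ck_on_affine_coord[OF o _ Ck_on_rvec[OF o]]) (simp add: S)
    have "smooth_on ?S (snd (affine_chart c) \<circ> rparam b)"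
      unfolding smooth_on_def using o Ck_on_cong[OF o eq[symmetric] C] by blast
    moreover have "inj (frechet_derivative (snd (affine_chart c) \<circ> rparam b) (at u))" if u: "u \<in> ?S" for u
    proof -
      obtain D where D: "((\<lambda>u. affine_coord c (rvec b u)) has_derivative D) (at u)"
        using Ck_on_SucD(1)[OF o C u] by blast
      have "((snd (affine_chart c) \<circ> rparam b) has_derivative D) (at u)"
        by (rule has_derivative_transform_within_open[OF D o u eq[symmetric]])
      then have "frechet_derivative (snd (affine_chart c) \<circ> rparam b) (at u) = D"
        by (simp add: frechet_derivative_at[symmetric])
      then show ?thesis using inj_affine_coord_rvec_derivative[OF _ D] u by (simp add: S)
    qed
    ultimately show ?thesis by blast
  qed
  show ?thesis
    unfolding local_param_def using open_rdom 1 2 3 by (auto simp: PsiCP3_atlas_eq case_prod_beta)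
qed

lemma rparam_cover: "circle_orbit ` PsiS3 = (\<Union>b. rparam b ` rdom)"
proof -
  have "\<exists>b. circle_orbit x \<in> fst (affine_chart b)" if "x \<in> PsiS3" for x
  proof -
    have x: "hq x = 1" using that by (simp add: PsiS3_iff)
    then obtain b where "hcoord b x \<noteq> 0" using hcoord_nonzero[of x] by auto
    then show ?thesis using hproj_in_chart[of x b] x by (auto simp: hproj_unit)
  qed
  then show ?thesis unfolding rparam_image by blast
qed

lemma embedded_PsiRP3: "embedded_submanifold TYPE(3) PsiCP3_atlas (circle_orbit ` PsiS3)"
  unfolding embedded_submanifold_def
proof (intro conjI ballI)
  show "circle_orbit ` PsiS3 \<subseteq> mspace_of PsiCP3_atlas"
    by (auto simp: mspace_of_PsiCP3_atlas PsiCP3_def PsiS7_iff PsiS3_iff)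
  fix Q assume "Q \<in> circle_orbit ` PsiS3"
  then obtain b where "Q \<in> rparam b ` rdom" using rparam_cover by blast
  then show "\<exists>p :: (H2 set, 3) param. local_param PsiCP3_atlas (circle_orbit ` PsiS3) p \<and> Q \<in> snd p ` fst p"
    using local_param_rparam[of b] by (intro exI[of _ "(rdom, rparam b)"]) simp
qed

lemma has_derivative_vec:
  fixes f :: "'a::real_normed_vector \<Rightarrow> real ^ 'n"
  assumes "\<And>i. ((\<lambda>x. f x $ i) has_derivative (\<lambda>v. f' v $ i)) (at a)"
  shows "(f has_derivative f') (at a)"
  using assms by (subst has_derivative_componentwise_within)
    (auto simp: Basis_vec_def inner_axis)

lemma rinv_affine_coord_rvec:
  "rinv (\<not> b) (affine_coord (\<not> b) (rvec b u))
     = vector [- 1 / u $ 1, rsign b * u $ 2 / u $ 1, rsign b * u $ 3 / u $ 1]"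
  by (cases b) (simp_all add: rinv_def affine_coord_eq rvec_def hom_pt_def hcoord_def rcoord_def
      rsign_def vec_eq_iff forall_3)

lemma det_transition:
  assumes u: "u $ 1 \<noteq> 0"
  shows "\<exists>D. ((\<lambda>u :: real ^ 3. rinv (\<not> b) (affine_coord (\<not> b) (rvec b u))) has_derivative D) (at u)
    \<and> det (matrix D) > 0"
proof -
  let ?D = "\<lambda>v :: real ^ 3. vector [v $ 1 / (u $ 1)\<^sup>2,
     rsign b * (v $ 2 * u $ 1 - u $ 2 * v $ 1) / (u $ 1)\<^sup>2,
     rsign b * (v $ 3 * u $ 1 - u $ 3 * v $ 1) / (u $ 1)\<^sup>2] :: real ^ 3"
  have c: "((\<lambda>u :: real ^ 3. u $ i) has_derivative (\<lambda>v. v $ i)) (at u)" for i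
    by (rule bounded_linear_imp_has_derivative[OF bounded_linear_vec_nth])
  have "((\<lambda>u :: real ^ 3. vector [- 1 / u $ 1, rsign b * u $ 2 / u $ 1, rsign b * u $ 3 / u $ 1] :: real ^ 3)
      has_derivative ?D) (at u)"
  proof (rule has_derivative_vec)
    note quot = has_derivative_divide'[OF _ c u, THEN has_derivative_eq_rhs]
    have "((\<lambda>u. - 1 / u $ 1) has_derivative (\<lambda>v. v $ 1 / (u $ 1)\<^sup>2)) (at u)"
      by (rule quot[OF has_derivative_const]) (simp add: power2_eq_square)
    moreover have "((\<lambda>u. rsign b * u $ i / u $ 1) has_derivative
        (\<lambda>v. rsign b * (v $ i * u $ 1 - u $ i * v $ 1) / (u $ 1)\<^sup>2)) (at u)" for i
      by (rule quot[OF has_derivative_mult_right[OF c]]) (simp add: power2_eq_square algebra_simps)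
    ultimately have "\<forall>i. ((\<lambda>u :: real ^ 3. (vector [- 1 / u $ 1, rsign b * u $ 2 / u $ 1, rsign b * u $ 3 / u $ 1] :: real ^ 3) $ i)
      has_derivative (\<lambda>v. ?D v $ i)) (at u)"
      unfolding forall_3 vector_3 by blast
    then show "((\<lambda>u :: real ^ 3. (vector [- 1 / u $ 1, rsign b * u $ 2 / u $ 1, rsign b * u $ 3 / u $ 1] :: real ^ 3) $ i)
      has_derivative (\<lambda>v. ?D v $ i)) (at u)" for i
      by blast
  qed
  moreover have "det (matrix ?D) = 1 / (u $ 1) ^ 4"
  proof -
    have "det (matrix ?D) = 1 / (u $ 1)\<^sup>2 * (rsign b * u $ 1 / (u $ 1)\<^sup>2) * (rsign b * u $ 1 / (u $ 1)\<^sup>2)"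
      by (simp add: det_3 matrix_def axis_def)
    also have "\<dots> = 1 / (u $ 1) ^ 4"
      using u by (simp add: rsign_def power2_eq_square power4_eq_xxxx)
    finally show ?thesis .
  qed
  moreover have "1 / (u $ 1) ^ 4 > 0" using u by simp
  ultimately show ?thesis unfolding rinv_affine_coord_rvec by (intro exI[of _ ?D]) simp
qed

lemma oriented_PsiRP3:
  "oriented_atlas PsiCP3_atlas (circle_orbit ` PsiS3) (range (\<lambda>b. (rdom, rparam b)))"
proof -
  have pos: "det (matrix (frechet_derivative (inv_into rdom (rparam c) \<circ> rparam b) (at u))) > 0"
    if u: "u \<in> rdom" and ru: "rparam b u \<in> rparam c ` rdom" for b c u
  proof -
    let ?f = "\<lambda>u. rinv c (affine_coord c (rvec b u))"
    let ?S = "rdom \<inter> {u. hcoord c (rvec b u) \<noteq> 0}"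
    have "continuous_on UNIV (\<lambda>u. hcoord c (rvec b u))"
      by (rule continuous_on_compose2[OF continuous_on_hcoord continuous_on_rvec]) auto
    then have o: "open ?S"
      by (intro open_Int open_rdom open_Collect_neq) auto
    have uS: "u \<in> ?S" using u ru rparam_in_chart[OF u, of b c] by (auto simp: rparam_image)
    have inj: "inj_on (rparam c) rdom"
      by (rule inj_on_inverseI[of _ "\<lambda>Q. rinv c (snd (affine_chart c) Q)"]) (rule rinv_chart_rparam)
    have eq: "?f x = (inv_into rdom (rparam c) \<circ> rparam b) x" if x: "x \<in> ?S" for x
    proof -
      have "rparam b x \<in> circle_orbit ` PsiS3" using x rparam_cover by blast
      moreover have "rparam b x \<in> fst (affine_chart c)" using x rparam_in_chart by blast
      ultimately obtain y where y: "y \<in> rdom" "rparam b x = rparam c y"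
        using rparam_image[of c] by blast
      have "?f x = rinv c (snd (affine_chart c) (rparam b x))" using x chart_rparam by auto
      also have "\<dots> = y" using y rinv_chart_rparam by simp
      finally show ?thesis using y inj by simp
    qed
    have "\<exists>D. (?f has_derivative D) (at u) \<and> det (matrix D) > 0"
    proof (cases "b = c")
      case True
      then show ?thesis by (intro exI[of _ "\<lambda>v. v"]) (simp add: matrix_id_mat_1[unfolded id_def])
    next
      case False
      then have c: "c = (\<not> b)" by auto
      then have "u $ 1 \<noteq> 0"
        using uS by (cases b) (auto simp: rvec_def hom_pt_def hcoord_def rcoord_def rsign_def)
      then show ?thesis unfolding c by (rule det_transition)
    qed
    then obtain D where D: "(?f has_derivative D) (at u)" "det (matrix D) > 0" by blast
    have "((inv_into rdom (rparam c) \<circ> rparam b) has_derivative D) (at u)"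
      by (rule has_derivative_transform_within_open[OF D(1) o uS eq])
    then show ?thesis using D(2) by (simp add: frechet_derivative_at[symmetric])
  qed
  show ?thesis
    unfolding oriented_atlas_def using local_param_rparam rparam_cover pos by auto
qed

section \<open>Real frames\<close>

definition std_frame :: "H2 \<Rightarrow> H2 ^ 2" where
  "std_frame x = vector [x, (qcnj (snd x), qcnj (fst x))]"

definition comega :: "H2 \<Rightarrow> H2 \<Rightarrow> complex ^ 3" where
  "comega x y = (case (x, y) of (((x1, x2), (x3, x4)), ((y1, y2), (y3, y4))) \<Rightarrow>
     vector [x1 * y3 - x3 * y1 - x2 * y4 + x4 * y2,
             x1 * y4 - x4 * y1 + x2 * y3 - x3 * y2,
             x1 * y2 - x2 * y1 - x3 * y4 + x4 * y3])"

lemma bounded_linear_std_frame: "bounded_linear std_frame"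
  unfolding linear_conv_bounded_linear[symmetric]
  by (rule linearI) (auto simp: std_frame_def qcnj_def vec_eq_iff forall_2 prod_eq_iff)

lemma PsiS3_cnj:
  assumes "((x1, x2), (x3, x4)) \<in> PsiS3"
  shows "cnj x1 = x1" "cnj x2 = x2" "cnj x3 = x3" "cnj x4 = x4"
    and "x1 * x1 + x2 * x2 - x3 * x3 - x4 * x4 = 1"
  using assms by (auto simp: PsiS3_def power2_eq_square simp flip: of_real_mult of_real_add of_real_diff)

lemma std_frame_in_frames:
  assumes "x \<in> PsiS3"
  shows "std_frame x \<in> frames"
proof -
  obtain x1 x2 x3 x4 where x: "x = ((x1, x2), (x3, x4))" by (metis prod.collapse)
  note r = PsiS3_cnj[OF assms[unfolded x]]
  have "x3 * x3 + x4 * x4 - x1 * x1 - x2 * x2 = - 1" using r(5) by (simp add: algebra_simps)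
  then show ?thesis
    using r(5) by (simp add: frames_def std_frame_def qdefs x r(1-4) prod_eq_iff algebra_simps)
qed

lemma frame_proj_std_frame: "frame_proj (std_frame x) = circle_orbit x"
  by (simp add: frame_proj_def std_frame_def)

lemma omega_std_frame:
  assumes "x \<in> PsiS3" "\<And>z. z \<in> {fst (fst (v $ 1)), snd (fst (v $ 1)), fst (snd (v $ 1)), snd (snd (v $ 1))} \<Longrightarrow> cnj z = z"
  shows "omega (std_frame x) v = comega x (v $ 1)"
proof -
  obtain x1 x2 x3 x4 where x: "x = ((x1, x2), (x3, x4))" by (metis prod.collapse)
  obtain y1 y2 y3 y4 where y: "v $ 1 = ((y1, y2), (y3, y4))" by (metis prod.collapse)
  note r = PsiS3_cnj[OF assms(1)[unfolded x]]
  have s: "cnj y1 = y1" "cnj y2 = y2" "cnj y3 = y3" "cnj y4 = y4" using assms(2) by (simp_all add: y)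
  show ?thesis
    unfolding omega_def mc_form_eq[OF std_frame_in_frames[OF assms(1)]]
    by (simp add: std_frame_def comega_def x y qdefs r s vec_eq_iff forall_3 algebra_simps)
qed

lemma comega_combination:
  "comega (s *\<^sub>R p) (m *\<^sub>R p + s *\<^sub>R d) = of_real (s\<^sup>2) *s comega p d"
proof -
  obtain p1 p2 p3 p4 where p: "p = ((p1, p2), (p3, p4))" by (metis prod.collapse)
  obtain d1 d2 d3 d4 where d: "d = ((d1, d2), (d3, d4))" by (metis prod.collapse)
  show ?thesis
    by (simp add: comega_def p d vec_eq_iff forall_3 scaleR_conv_of_real power2_eq_square algebra_simps)
qed

section \<open>The structure tensors on a real frame\<close>

lemma frame_Psi_real:
  assumes "\<And>i j. omega e (v j) $ i = of_real (R $ i $ j)"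
  shows "frame_Psi e v = of_real (det R)"
  by (simp add: frame_Psi_def det_3 assms)

lemma frame_metric_real:
  assumes "\<And>i j. omega e (v j) $ i = of_real (R $ i $ j)"
  shows "frame_metric e (pair_family (v j) (v k)) = (transpose R ** R) $ j $ k"
proof -
  have "(2 :: 2) \<noteq> 1" by simp
  then show ?thesis
    by (simp add: frame_metric_def pair_family_def assms matrix_matrix_mult_def transpose_def
      sum_3 algebra_simps)
qed

lemma Psi_eq_volume:
  assumes e: "e \<in> frames" and c: "\<And>i. frame_curve e (\<gamma> i) (v i)"
    and X: "\<And>i. X i = velocity PsiCP3_atlas (frame_proj \<circ> \<gamma> i)"
    and R: "\<And>i j. omega e (v j) $ i = of_real (R $ i $ j)" and pos: "det R \<ge> 0"
  shows "Re (su3_Psi PsiCP3_su3 X) = volume_coeff (su3_metric PsiCP3_su3) X"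
proof -
  have "X = (\<lambda>i. velocity PsiCP3_atlas (frame_proj \<circ> \<gamma> i))" using X by blast
  then have "su3_Psi PsiCP3_su3 X = of_real (det R)"
    using pullback_Psi[OF e c] frame_Psi_real[OF R] by simp
  moreover have "su3_metric PsiCP3_su3 (pair_family (X j) (X k)) = (transpose R ** R) $ j $ k" for j k
  proof -
    have X_eq: "pair_family (X j) (X k)
        = (\<lambda>i. velocity PsiCP3_atlas (frame_proj \<circ> pair_family (\<gamma> j) (\<gamma> k) i))"
      by (simp add: fun_eq_iff pair_family_def X)
    have "frame_curve e (pair_family (\<gamma> j) (\<gamma> k) i) (pair_family (v j) (v k) i)" for i
      using c by (simp add: pair_family_def)
    then show ?thesis
      unfolding X_eq frame_metric_real[where v = v, OF R, symmetric] by (rule pullback_metric[OF e])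
  qed
  then have "volume_coeff (su3_metric PsiCP3_su3) X = sqrt (det (transpose R ** R))"
    by (simp add: volume_coeff_def)
  then have "volume_coeff (su3_metric PsiCP3_su3) X = det R"
    using pos by (simp add: det_mul)
  ultimately show ?thesis by simp
qed

lemma has_velocity_cong:
  assumes "\<forall>\<^sub>F t in nhds 0. c t = c' t"
  shows "has_velocity d c w \<longleftrightarrow> has_velocity d c' w"
proof -
  have "(\<forall>\<^sub>F t in nhds 0. c t \<in> fst d) \<longleftrightarrow> (\<forall>\<^sub>F t in nhds 0. c' t \<in> fst d)"
    by (rule eventually_subst) (use assms in \<open>auto elim: eventually_mono\<close>)
  moreover have "((snd d \<circ> c) has_vector_derivative w) (at 0) \<longleftrightarrow> ((snd d \<circ> c') has_vector_derivative w) (at 0)"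
    by (rule has_vector_derivative_cong_ev)
      (use assms eventually_nhds_x_imp_x[OF assms] in \<open>auto elim: eventually_mono\<close>)
  ultimately show ?thesis by (simp add: has_velocity_def)
qed

lemma velocity_cong:
  assumes "\<forall>\<^sub>F t in nhds 0. c t = c' t"
  shows "velocity A c = velocity A c'"
  unfolding velocity_def has_velocity_cong[OF assms] eventually_nhds_x_imp_x[OF assms] by simp

section \<open>Coordinate vectors of the real parametrizations\<close>

definition rpoint :: "bool \<Rightarrow> real ^ 3 \<Rightarrow> H2" where
  "rpoint b u = (1 / sqrt (hq (rvec b u))) *\<^sub>R rvec b u"

lemma rparam_eq_frame_proj: "rparam b u = frame_proj (std_frame (rpoint b u))"
  by (simp add: rparam_def hproj_def frame_proj_std_frame rpoint_def)

lemma rpoint_in_PsiS3: "u \<in> rdom \<Longrightarrow> rpoint b u \<in> PsiS3"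
  by (simp add: rpoint_def normalized_rvec_in_PsiS3)

lemma rpoint_derivative:
  assumes "u \<in> rdom"
  shows "\<exists>m. ((\<lambda>t. rpoint b (u + t *\<^sub>R d)) has_vector_derivative
     m *\<^sub>R rvec b u + (1 / sqrt (hq (rvec b u))) *\<^sub>R rdir b d) (at 0)"
proof -
  have "rvec b (u + t *\<^sub>R d) = rvec b u + t *\<^sub>R rdir b d" for t
    by (simp add: rvec_add linear_simps(5)[OF bounded_linear_rdir])
  moreover have "((\<lambda>t. rvec b u + t *\<^sub>R rdir b d) has_vector_derivative rdir b d) (at 0)"
    by (auto intro!: derivative_eq_intros)
  ultimately have f: "((\<lambda>t. rvec b (u + t *\<^sub>R d)) has_vector_derivative rdir b d) (at 0)" by simp
  have pos: "0 < 1 + (u $ 1)\<^sup>2 - (u $ 2)\<^sup>2 - (u $ 3)\<^sup>2" using assms by (simp add: rdom_def)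
  have "\<exists>m. ((\<lambda>t. 1 / sqrt (hq (rvec b (u + t *\<^sub>R d)))) has_real_derivative m) (at 0)"
    unfolding hq_rvec by (rule exI) (use pos in \<open>auto intro!: derivative_eq_intros\<close>)
  then obtain m where "((\<lambda>t. 1 / sqrt (hq (rvec b (u + t *\<^sub>R d)))) has_real_derivative m) (at 0)" ..
  from has_vector_derivative_scaleR[OF this f] show ?thesis
    unfolding rpoint_def by (intro exI[of _ m]) (simp add: add.commute)
qed

definition romega :: "bool \<Rightarrow> real ^ 3 \<Rightarrow> real ^ 3 ^ 3" where
  "romega b u = (if b
     then vector [vector [u $ 3, 1, - u $ 1], vector [- u $ 2, u $ 1, 1], vector [1, u $ 3, - u $ 2]]
     else vector [vector [u $ 2, - u $ 1, - 1], vector [u $ 3, 1, - u $ 1], vector [1, u $ 3, - u $ 2]])"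

lemma comega_rvec: "comega (rvec b u) (rdir b (axis j 1)) $ i = of_real (romega b u $ i $ j)"
proof -
  have "\<forall>i j. comega (rvec b u) (rdir b (axis j 1)) $ i = of_real (romega b u $ i $ j)"
    unfolding forall_3
    by (cases b) (simp_all add: comega_def romega_def rvec_def hom_pt_def rcoord_def rdir_def rsign_def axis_def)
  then show ?thesis by blast
qed

lemma det_romega: "det (romega b u) = hq (rvec b u)"
  by (cases b) (simp_all add: romega_def det_3 hq_rvec power2_eq_square)

lemma Psi_coord_vector:
  assumes u: "u \<in> rdom"
  shows "Re (su3_Psi PsiCP3_su3 (coord_vector PsiCP3_atlas (rparam b) u))
     = volume_coeff (su3_metric PsiCP3_su3) (coord_vector PsiCP3_atlas (rparam b) u)"
proof -
  let ?s = "1 / sqrt (hq (rvec b u))"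
  let ?e = "std_frame (rpoint b u)"
  have "\<forall>i. \<exists>m. ((\<lambda>t. rpoint b (u + t *\<^sub>R axis i 1)) has_vector_derivative
      m *\<^sub>R rvec b u + ?s *\<^sub>R rdir b (axis i 1)) (at 0)"
    by (intro allI rpoint_derivative u)
  from choice[OF this] obtain m where m: "((\<lambda>t. rpoint b (u + t *\<^sub>R axis i 1)) has_vector_derivative
      m i *\<^sub>R rvec b u + ?s *\<^sub>R rdir b (axis i 1)) (at 0)" for i
    by blast
  define w where "w i = m i *\<^sub>R rvec b u + ?s *\<^sub>R rdir b (axis i 1)" for i :: 3
  define \<gamma> where "\<gamma> i t = std_frame (rpoint b (if u + t *\<^sub>R axis i 1 \<in> rdom then u + t *\<^sub>R axis i 1 else u))"
    for i :: 3 and t :: real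
  have dom: "\<forall>\<^sub>F t in nhds 0. u + t *\<^sub>R axis i 1 \<in> rdom" for i :: 3
  proof -
    have "((\<lambda>t. u + t *\<^sub>R axis i 1) \<longlongrightarrow> u + 0 *\<^sub>R axis i 1) (nhds 0)"
      by (intro tendsto_intros filterlim_ident)
    then show ?thesis using open_rdom u by (auto simp: tendsto_def)
  qed
  have ev: "\<forall>\<^sub>F t in nhds 0. std_frame (rpoint b (u + t *\<^sub>R axis i 1)) = \<gamma> i t" for i
    by (rule eventually_mono[OF dom[of i]]) (simp add: \<gamma>_def)
  have X: "coord_vector PsiCP3_atlas (rparam b) u i = velocity PsiCP3_atlas (frame_proj \<circ> \<gamma> i)" for i
    unfolding coord_vector_def
    by (rule velocity_cong) (rule eventually_mono[OF ev[of i]], simp add: rparam_eq_frame_proj)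
  have c: "frame_curve ?e (\<gamma> i) (std_frame (w i))" for i
    unfolding frame_curve_def
  proof (intro conjI allI)
    show "\<gamma> i 0 = ?e" by (simp add: \<gamma>_def)
    show "\<gamma> i t \<in> frames" for t
      using u by (auto simp: \<gamma>_def intro!: std_frame_in_frames rpoint_in_PsiS3)
    have "((\<lambda>t. std_frame (rpoint b (u + t *\<^sub>R axis i 1))) has_vector_derivative std_frame (w i)) (at 0)"
      unfolding w_def by (rule bounded_linear.has_vector_derivative[OF bounded_linear_std_frame m])
    moreover have "\<forall>\<^sub>F t in nhds 0. t \<in> UNIV \<longrightarrow> std_frame (rpoint b (u + t *\<^sub>R axis i 1)) = \<gamma> i t"
      using ev[of i] by (rule eventually_mono) simp
    note has_vector_derivative_cong_ev[OF this eventually_nhds_x_imp_x[OF ev[of i]]]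
    ultimately show "(\<gamma> i has_vector_derivative std_frame (w i)) (at 0)" by simp
  qed
  have "omega ?e (std_frame (w j)) = comega (rpoint b u) (w j)" for j
  proof -
    have "std_frame (w j) $ 1 = w j" by (simp add: std_frame_def)
    moreover have "cnj z = z" if "z \<in> {fst (fst (w j)), snd (fst (w j)), fst (snd (w j)), snd (snd (w j))}" for z
      using that by (auto simp: w_def rvec_def hom_pt_def rcoord_def rdir_def)
    ultimately show ?thesis using omega_std_frame[OF rpoint_in_PsiS3[OF u], of "std_frame (w j)" b] by metis
  qed
  then have R: "omega ?e (std_frame (w j)) $ i = of_real ((?s\<^sup>2 *\<^sub>R romega b u) $ i $ j)" for i j
    unfolding w_def rpoint_def comega_combination by (simp add: comega_rvec)
  have "det (?s\<^sup>2 *\<^sub>R romega b u) = (?s\<^sup>2) ^ 3 * det (romega b u)"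
    by (simp add: det_3 power3_eq_cube algebra_simps)
  then have "det (?s\<^sup>2 *\<^sub>R romega b u) \<ge> 0"
    using u by (simp add: det_romega rdom_iff[of _ b])
  from Psi_eq_volume[OF std_frame_in_frames[OF rpoint_in_PsiS3[OF u]] c X R this] show ?thesis .
qed

theorem theorem5p2:
  shows "special_lagrangian PsiCP3_atlas PsiCP3_su3 (PsiRP3_incl ` PsiRP3)"
  unfolding special_lagrangian_def PsiRP3_image
  using embedded_PsiRP3 oriented_PsiRP3 Psi_coord_vector
  by (intro conjI exI[of _ "range (\<lambda>b. (rdom, rparam b))"]) auto

end
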